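(* Let $a\ge0$ and let $f(t)$ be a probability density with support $[a,\infty)$ which is continuous on $(a,\infty)$. Then $f$ is the density of a selfdecomposable distribution if and only if $f$ satisfies $$(a-t)f(t)+\int_a^t\nu\big((t-s,\infty)\big)f(s)\,ds=0,\qquad t\ge a,$$ for some L\'evy measure $\nu$ on $(0,\infty)$ such that $\int_0^\infty\log^+(x)\,\nu(dx)<\infty$.
   Context: A probability law $\mu$ is selfdecomposable if, for $X\sim\mu$ and every $c\in(0,1)$, there is a random variable $Y_c$ such that $X\overset{d}{=}cX'+Y_c$, where $X'$ is a copy of $X$ independent of $Y_c$. L\'evy measures here are those of subordinators, i.e. measures $\nu$ on $(0,\infty)$ with $\int_{(0,\infty)}\min(1,x)\,\nu(dx)<\infty$. *)

theory Defs
  imports "HOL-Probability.Probability"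
begin

text \<open>
  The existence of a random variable \<open>Y\<close> independent of a copy \<open>X'\<close> of \<open>X\<close> is read as the
  existence of a probability space carrying both. Since only the joint law of \<open>(X', Y)\<close>
  matters, restricting the sample space to the type \<open>real \<times> real\<close> loses no generality.
\<close>

definition selfdecomposable :: "real measure \<Rightarrow> bool" where
  "selfdecomposable \<mu> \<longleftrightarrow> real_distribution \<mu> \<and>
     (\<forall>c\<in>{0<..<1}. \<exists>(M :: (real \<times> real) measure) X' Y.
        prob_space M \<and>
        prob_space.indep_var M borel X' borel Y \<and>
        distr M borel X' = \<mu> \<and>
        distr M borel (\<lambda>\<omega>. c * X' \<omega> + Y \<omega>) = \<mu>)"

text \<open>
  A measure on \<open>(0, \<infinity>)\<close> is encoded as a Borel measure on the line that does not charge
  \<open>(-\<infinity>, 0]\<close>.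
\<close>

definition subordinator_levy_measure :: "real measure \<Rightarrow> bool" where
  "subordinator_levy_measure \<nu> \<longleftrightarrow>
     sets \<nu> = sets borel \<and>
     emeasure \<nu> {..0} = 0 \<and>
     (\<integral>\<^sup>+x\<in>{0<..}. ennreal (min 1 x) \<partial>\<nu>) < \<infinity>"

definition ln_plus :: "real \<Rightarrow> real" where
  "ln_plus x = max 0 (ln x)"

end

theory Submission
  imports Defs
begin

text \<open>
  Write \<open>\<phi>\<close> for the Laplace transform of \<open>\<mu>\<close> and \<open>K(l)\<close> for the integral of \<open>1 - exp (- l x)\<close> against
  \<open>\<nu>\<close>. Since the tail of \<open>\<nu>\<close> has Laplace transform \<open>K(l) / l\<close>, the integral equation is, up to null
  sets, the relation \<open>- \<phi>'(l) = (a + K(l) / l) \<phi>(l)\<close>.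

  Given that relation, integrating the logarithmic derivative shows that \<open>\<phi>(l) / \<phi>(c l)\<close> is
  \<open>exp (- a (1 - c) l)\<close> times the exponential of minus the integral of \<open>K(l v) / v\<close> over \<open>c \<le> v \<le> 1\<close>.
  This is the Laplace transform of a subordinator with drift whose Levy measure is the image of
  \<open>\<nu>(dx) dv / v\<close> under \<open>(x, v) \<mapsto> x v\<close>.

  Conversely, if \<open>Y\<^sub>c\<close> denotes the remainder of a selfdecomposable law, then \<open>Y\<^sub>c \<ge> 0\<close> by the support
  assumption, and \<open>(1 - E exp (- l Y\<^sub>c)) / (1 - c)\<close> tends to \<open>k(l) = - l \<phi>'(l) / \<phi>(l)\<close> as \<open>c\<close> tends to
  \<open>1\<close>. The laws of \<open>Y\<^sub>c\<close>, reweighted by \<open>1 - exp (- y)\<close> and normalised, are tight, and a weak limit of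
  them yields a drift \<open>b\<close> and a Levy measure with \<open>k(l) = b l + K(l)\<close>. Inverting the transform gives
  the integral equation almost everywhere, the support forces \<open>b = a\<close>, and continuity of both sides on
  the open half-line removes the exceptional set.
\<close>

section \<open>Uniqueness of Laplace transforms\<close>

text \<open>The mean of \<mu> may be infinite, so the two sides of the integral equation are
  compared as possibly infinite measures on the half-line, with transforms in \<open>ennreal\<close>
  that are finite for l > 0. Such measures are determined by the transform at l = 1, 2, 3, ...,
  which is why the Levy-Khintchine formula is established at the integers only. As c tends to 1 the
  remainders collapse to the point mass at 0. The weight 1 - exp (- y) ignores what sits at 0, and
  its total mass is of order 1 - c, so normalising magnifies the small jumps to a probability law.
  If k(l) = b l + K(l), then k(l + 1) - k(l) is the transform of b times the unit mass at 0 plus (1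
  - exp (- y)) \<nu>(dy), a finite measure of mass k(1); the weak limit is this measure normalised,
  and its atom at 0 carries the drift. The logarithmic moment comes from the relation itself: the
  integral of K(v) / v over c \<le> v \<le> 1 is at most - ln \<phi>(1) for every c.\<close>

definition lap :: "real measure \<Rightarrow> real \<Rightarrow> ennreal" where
  "lap M l = (\<integral>\<^sup>+x. ennreal (exp (- (l * x))) \<partial>M)"

lemma integrable_AE_bounded:
  assumes "finite_measure M" "f \<in> borel_measurable M" "AE x in M. norm (f x) \<le> (B::real)"
  shows "integrable M (f :: 'a \<Rightarrow> real)"
  using assms by (intro finite_measure.integrable_const_bound)

lemma
  assumes M: "finite_measure M" and [measurable_cong]: "sets M = sets borel"
    and nn: "AE x in M. 0 \<le> x" and l: "0 \<le> l"
  shows lap_integrable: "integrable M (\<lambda>x. exp (- (l * x)))"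
    and lap_eq_integral: "lap M l = ennreal (\<integral>x. exp (- (l * x)) \<partial>M)"
proof -
  show *: "integrable M (\<lambda>x. exp (- (l * x)))"
    by (rule integrable_AE_bounded[OF M, where B=1]) (use nn l in \<open>auto elim!: eventually_mono\<close>)
  show "lap M l = ennreal (\<integral>x. exp (- (l * x)) \<partial>M)"
    unfolding lap_def using * by (intro nn_integral_eq_integral) auto
qed

text \<open>The transform at n is the n-th moment of exp (- x), which lies in [0, 1]. Weierstrass
  approximation extends equality of moments to continuous functions of exp (- x), and these
  approximate indicators of half-lines, so the distribution functions agree.\<close>

lemma lap_determines_finite_measure:
  assumes M: "finite_measure M" and sM[measurable_cong]: "sets M = sets borel" and nM: "AE x in M. 0 \<le> x"
    and N: "finite_measure N" and sN[measurable_cong]: "sets N = sets borel" and nN: "AE x in N. 0 \<le> x"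
    and eq: "\<And>n::nat. lap M (real n) = lap N (real n)"
  shows "M = N"
proof -
  have pow: "exp (- x) ^ n = exp (- (real n * x))" for x :: real and n :: nat
    by (simp add: exp_of_nat_mult[symmetric])
  have mono_eq: "(\<integral>x. exp (- x) ^ n \<partial>M) = (\<integral>x. exp (- x) ^ n \<partial>N)" for n :: nat
    using eq[of n] lap_eq_integral[OF M sM nM, of n] lap_eq_integral[OF N sN nN, of n]
    by (simp add: pow)
  have int_pow: "integrable M (\<lambda>x. exp (- x) ^ n)" "integrable N (\<lambda>x. exp (- x) ^ n)" for n :: nat
    using lap_integrable[OF M sM nM, of n] lap_integrable[OF N sN nN, of n] by (simp_all add: pow)
  have cont_eq: "(\<integral>x. h (exp (- x)) \<partial>M) = (\<integral>x. h (exp (- x)) \<partial>N)"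
    if h: "continuous_on UNIV h" and B: "\<And>u. \<bar>h u\<bar> \<le> 1" for h :: "real \<Rightarrow> real"
  proof -
    define m where "m = measure M (space M) + measure N (space N)"
    have [measurable]: "h \<in> borel_measurable borel"
      using h by (rule borel_measurable_continuous_onI)
    have ih: "integrable M (\<lambda>x. h (exp (- x)))" "integrable N (\<lambda>x. h (exp (- x)))"
      by (rule integrable_AE_bounded[OF M, where B=1], use B in auto)
        (rule integrable_AE_bounded[OF N, where B=1], use B in auto)
    have close: "\<bar>(\<integral>x. h (exp (- x)) \<partial>M) - (\<integral>x. h (exp (- x)) \<partial>N)\<bar> \<le> e * m" if e: "0 < e" for e
    proof -
      obtain g where g: "real_polynomial_function g" "\<And>x. x \<in> {0..1} \<Longrightarrow> \<bar>h x - g x\<bar> < e"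
        using Stone_Weierstrass_real_polynomial_function[of "{0..1}" h e] e h
        by (auto intro: continuous_on_subset)
      obtain a n where ga: "g = (\<lambda>x. \<Sum>i\<le>n. a i * x ^ i)"
        using g(1) unfolding real_polynomial_function_iff_sum by blast
      have ig: "integrable M (\<lambda>x. g (exp (- x)))" "integrable N (\<lambda>x. g (exp (- x)))"
        unfolding ga using int_pow by (auto intro!: Bochner_Integration.integrable_sum)
      have eg: "(\<integral>x. g (exp (- x)) \<partial>M) = (\<integral>x. g (exp (- x)) \<partial>N)"
        unfolding ga using int_pow by (simp add: mono_eq)
      have bound: "\<bar>(\<integral>x. h (exp (- x)) \<partial>P) - (\<integral>x. g (exp (- x)) \<partial>P)\<bar> \<le> e * measure P (space P)"
        if P: "finite_measure P" "AE x in P. 0 \<le> x" "integrable P (\<lambda>x. h (exp (- x)))"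
          "integrable P (\<lambda>x. g (exp (- x)))" for P
      proof -
        have "\<bar>\<integral>x. h (exp (- x)) - g (exp (- x)) \<partial>P\<bar> \<le> (\<integral>x. \<bar>h (exp (- x)) - g (exp (- x))\<bar> \<partial>P)"
          by (rule integral_abs_bound)
        also have "\<dots> \<le> (\<integral>x. e \<partial>P)"
        proof (rule integral_mono_AE)
          show "AE x in P. \<bar>h (exp (- x)) - g (exp (- x))\<bar> \<le> e"
            using P(2) by eventually_elim (use g(2) in \<open>auto intro!: less_imp_le\<close>)
          show "integrable P (\<lambda>x. e)" using P(1) by (simp add: finite_measure.integrable_const)
        qed (use P in auto)
        finally show ?thesis using P by (simp add: mult.commute)
      qed
      show ?thesis using bound[OF M nM ih(1) ig(1)] bound[OF N nN ih(2) ig(2)] eg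
        unfolding m_def distrib_left by linarith
    qed
    have m0: "0 \<le> m" unfolding m_def by simp
    have "\<bar>(\<integral>x. h (exp (- x)) \<partial>M) - (\<integral>x. h (exp (- x)) \<partial>N)\<bar> \<le> 0 + d" if "0 < d" for d
    proof -
      \<comment> \<open>Dividing by m + 1 instead of m covers the case where both measures are
        zero.\<close>
      have "d / (m + 1) * m \<le> d" using m0 that by (simp add: field_simps)
      then show ?thesis using close[of "d / (m + 1)"] m0 that by simp
    qed
    then have "\<bar>(\<integral>x. h (exp (- x)) \<partial>M) - (\<integral>x. h (exp (- x)) \<partial>N)\<bar> \<le> 0"
      by (rule field_le_epsilon)
    then show ?thesis by simp
  qed
  \<comment> \<open>A ramp in u = exp (- x): it is 1 for u \<ge> exp (- b) and falls to 0 over a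
    length 1 / k below that point. Being 1 on all of x \<le> b, it converges to the indicator of the
    closed half-line, the one that \<open>cdf\<close> measures.\<close>
  define h where "h b k u = max 0 (min 1 (real k * (u - exp (- b)) + 1))" for b u :: real and k
  have lim_h: "(\<lambda>k. h b k (exp (- x))) \<longlonglongrightarrow> indicator {..b} x" for b x
  proof (cases "x \<le> b")
    case True
    then have "h b k (exp (- x)) = 1" for k by (simp add: h_def)
    then show ?thesis using True by simp
  next
    case False
    then have p: "0 < exp (- b) - exp (- x)" by simp
    have "eventually (\<lambda>k. real k * (exp (- b) - exp (- x)) \<ge> 1) sequentially"
      using p by real_asymp
    then have "eventually (\<lambda>k. h b k (exp (- x)) = 0) sequentially"
      by eventually_elim (auto simp: h_def algebra_simps)
    then show ?thesis using False by (auto intro: tendsto_eventually)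
  qed
  have cdf_lim: "(\<lambda>k. \<integral>x. h b k (exp (- x)) \<partial>P) \<longlonglongrightarrow> cdf P b"
    if P: "finite_measure P" and [measurable_cong]: "sets P = sets borel" for P b
  proof -
    have "(\<lambda>k. \<integral>x. h b k (exp (- x)) \<partial>P) \<longlonglongrightarrow> (\<integral>x. indicator {..b} x \<partial>P)"
    proof (rule integral_dominated_convergence[where w="\<lambda>x. 1"])
      show "(\<lambda>x. h b k (exp (- x))) \<in> borel_measurable P" for k unfolding h_def by measurable
      show "AE x in P. (\<lambda>k. h b k (exp (- x))) \<longlonglongrightarrow> indicator {..b} x" using lim_h by simp
      show "AE x in P. norm (h b k (exp (- x))) \<le> 1" for k by (simp add: h_def)
    qed (use P in \<open>auto simp: finite_measure.integrable_const\<close>)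
    moreover have "(\<integral>x. indicator {..b} x \<partial>P) = cdf P b"
      using sets_eq_imp_space_eq[OF that(2)] by (simp add: cdf_def)
    ultimately show ?thesis by simp
  qed
  have "cdf M b = cdf N b" for b
  proof (rule LIMSEQ_unique[OF cdf_lim[OF M sM]])
    have "(\<integral>x. h b k (exp (- x)) \<partial>M) = (\<integral>x. h b k (exp (- x)) \<partial>N)" for k
      by (rule cont_eq) (auto simp: h_def intro!: continuous_intros)
    then show "(\<lambda>k. \<integral>x. h b k (exp (- x)) \<partial>M) \<longlonglongrightarrow> cdf N b" using cdf_lim[OF N sN] by simp
  qed
  then show "M = N"
    by (intro cdf_unique' ext finite_borel_measure.intro finite_borel_measure_axioms.intro M N)
      (use sM sN in auto)
qed

text \<open>Tilting by exp (- x) shifts the argument of the transform by 1, makes a measure with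
  finite \<open>lap M 1\<close> finite, and is undone by the density exp x. This reaches infinite
  measures such as t f(t) dt when the mean is infinite.\<close>

lemma lap_determines_measure:
  assumes sM[measurable_cong]: "sets M = sets borel" and nM: "AE x in M. 0 \<le> x"
    and sN[measurable_cong]: "sets N = sets borel" and nN: "AE x in N. 0 \<le> x"
    and fin: "lap M 1 < \<infinity>" and eq: "\<And>n::nat. 1 \<le> n \<Longrightarrow> lap M (real n) = lap N (real n)"
  shows "M = N"
proof -
  define T where "T P = density P (\<lambda>x. ennreal (exp (- x)))" for P :: "real measure"
  have fT: "finite_measure (T P)" if "lap P 1 < \<infinity>" "sets P = sets borel" for P
  proof
    have [measurable_cong]: "sets P = sets borel" by fact
    show "emeasure (T P) (space (T P)) \<noteq> \<infinity>"
      using that by (auto simp: T_def lap_def emeasure_density sets_eq_imp_space_eq)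
  qed
  have lapT: "lap (T P) l = lap P (l + 1)" if "sets P = sets borel" for P l
  proof -
    have [measurable_cong]: "sets P = sets borel" by fact
    show ?thesis unfolding lap_def T_def
      by (subst nn_integral_density)
        (auto intro!: nn_integral_cong simp: ennreal_mult[symmetric] mult_exp_exp algebra_simps)
  qed
  have untilt: "density (T P) (\<lambda>x. ennreal (exp x)) = P" if "sets P = sets borel" for P
  proof -
    have [measurable_cong]: "sets P = sets borel" by fact
    have "density (T P) (\<lambda>x. ennreal (exp x)) = density P (\<lambda>x. ennreal (exp (- x)) * ennreal (exp x))"
      unfolding T_def by (rule density_density_eq) auto
    also have "\<dots> = density P (\<lambda>x. 1)"
      by (intro density_cong) (auto simp: ennreal_mult[symmetric] mult_exp_exp)
    finally show ?thesis by (simp add: density_1)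
  qed
  have "T M = T N"
  proof (rule lap_determines_finite_measure)
    show "finite_measure (T M)" using fT fin sM by blast
    show "finite_measure (T N)" using fT fin sN eq[of 1] by simp
    show "AE x in T M. 0 \<le> x" "AE x in T N. 0 \<le> x"
      unfolding T_def using nM nN by (simp_all add: AE_density)
    show "lap (T M) (real n) = lap (T N) (real n)" for n
      using eq[of "Suc n"] lapT[OF sM, of n] lapT[OF sN, of n] by (simp add: add.commute)
  qed (use sM sN in \<open>simp_all add: T_def\<close>)
  then show ?thesis using untilt[OF sM] untilt[OF sN] by metis
qed

section \<open>Laplace transforms of laws on the half-line\<close>

definition nonneg_law :: "real measure \<Rightarrow> bool" where
  "nonneg_law M \<longleftrightarrow> real_distribution M \<and> (AE x in M. 0 \<le> x)"

definition laplace :: "real measure \<Rightarrow> real \<Rightarrow> real" where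
  "laplace M l = (\<integral>x. exp (- (l * x)) \<partial>M)"

lemma AE_nonneg_iff:
  fixes M :: "real measure"
  assumes "sets M = sets borel"
  shows "(AE x in M. 0 \<le> x) \<longleftrightarrow> emeasure M {..<0} = 0"
  using assms by (subst AE_iff_measurable[of "{..<0}"]) (auto simp: sets_eq_imp_space_eq)

lemma nonneg_lawI:
  assumes "prob_space M" "sets M = sets borel" "AE x in M. 0 \<le> x"
  shows "nonneg_law M"
  using assms unfolding nonneg_law_def real_distribution_def real_distribution_axioms_def by simp

lemma nonneg_lawD:
  assumes "nonneg_law M"
  shows "prob_space M" "finite_measure M" "sets M = sets borel" "AE x in M. 0 \<le> x" "real_distribution M"
  using assms unfolding nonneg_law_def real_distribution_def real_distribution_axioms_def
  by (auto simp: prob_space.finite_measure)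

lemma
  assumes "nonneg_law M" "0 \<le> l"
  shows laplace_integrable: "integrable M (\<lambda>x. exp (- (l * x)))"
    and lap_eq_laplace: "lap M l = ennreal (laplace M l)"
  using lap_integrable[of M l] lap_eq_integral[of M l] nonneg_lawD[OF assms(1)] assms(2)
  by (auto simp: laplace_def)

lemma laplace_pos:
  assumes M: "nonneg_law M" and l: "0 \<le> l"
  shows "0 < laplace M l"
proof -
  interpret prob_space M using nonneg_lawD(1)[OF M] .
  have "(\<integral>x. exp (- (l * x)) \<partial>M) \<noteq> 0"
  proof
    assume "(\<integral>x. exp (- (l * x)) \<partial>M) = 0"
    then have "AE x in M. exp (- (l * x)) = 0"
      by (subst (asm) integral_nonneg_eq_0_iff_AE[OF laplace_integrable[OF M l]]) auto
    then show False using AE_const[of False] by simp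
  qed
  moreover have "0 \<le> (\<integral>x. exp (- (l * x)) \<partial>M)" by simp
  ultimately show ?thesis unfolding laplace_def by linarith
qed

lemma laplace_antimono:
  assumes M: "nonneg_law M" and l: "0 \<le> l" "l \<le> l'"
  shows "laplace M l' \<le> laplace M l"
  unfolding laplace_def
proof (rule integral_mono_AE)
  show "AE x in M. exp (- (l' * x)) \<le> exp (- (l * x))"
    using nonneg_lawD(4)[OF M] by eventually_elim (use l in \<open>auto intro: mult_right_mono\<close>)
qed (use laplace_integrable[OF M] l in auto)

section \<open>Continuity theorem for Laplace transforms\<close>

lemma laplace_tendsto_1:
  assumes M: "nonneg_law M"
  shows "(laplace M \<longlongrightarrow> 1) (at_right 0)"
  unfolding tendsto_at_iff_sequentially
proof (intro allI impI)
  fix X :: "nat \<Rightarrow> real" assume X: "\<forall>i. X i \<in> {0<..} - {0}" "X \<longlonglongrightarrow> 0"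
  interpret prob_space M using nonneg_lawD(1)[OF M] .
  have [measurable_cong]: "sets M = sets borel" using nonneg_lawD(3)[OF M] .
  have "(\<lambda>n. \<integral>x. exp (- (X n * x)) \<partial>M) \<longlonglongrightarrow> (\<integral>x. 1 \<partial>M)"
  proof (rule integral_dominated_convergence[where w="\<lambda>x. 1"])
    show "AE x in M. (\<lambda>n. exp (- (X n * x))) \<longlonglongrightarrow> 1"
    proof (rule AE_I2)
      fix x
      have "(\<lambda>n. exp (- (X n * x))) \<longlonglongrightarrow> exp (- (0 * x))" by (intro tendsto_intros X)
      then show "(\<lambda>n. exp (- (X n * x))) \<longlonglongrightarrow> 1" by simp
    qed
    show "AE x in M. norm (exp (- (X n * x))) \<le> 1" for n
      using nonneg_lawD(4)[OF M] X(1) by (auto elim!: eventually_mono simp: less_imp_le)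
  qed auto
  then show "(laplace M \<circ> X) \<longlonglongrightarrow> 1" by (simp add: laplace_def comp_def prob_space)
qed

text \<open>A Markov-type bound: beyond 1 / l the function 1 - exp (- l x) is at least 1 / 2,
  because e \<ge> 2. The transform near 0 thus controls the mass far out.\<close>

lemma laplace_tail_bound:
  assumes M: "nonneg_law M" and l: "0 < l"
  shows "measure M {1 / l<..} \<le> 2 * (1 - laplace M l)"
proof -
  interpret prob_space M using nonneg_lawD(1)[OF M] .
  have sM[measurable_cong, simp]: "sets M = sets borel" using nonneg_lawD(3)[OF M] .
  have i: "integrable M (\<lambda>x. exp (- (l * x)))" using laplace_integrable[OF M] l by simp
  have "measure M {1 / l<..} = (\<integral>x. indicator {1 / l<..} x \<partial>M)"
    using sets_eq_imp_space_eq[OF sM] by simp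
  also have "\<dots> \<le> (\<integral>x. 2 * (1 - exp (- (l * x))) \<partial>M)"
  proof (rule integral_mono_AE)
    show "AE x in M. indicator {1 / l<..} x \<le> 2 * (1 - exp (- (l * x)))"
      using nonneg_lawD(4)[OF M]
    proof eventually_elim
      case (elim x)
      have "exp (- (l * x)) \<le> 1 / 2" if "1 / l < x"
      proof -
        have "1 < l * x" using that l by (simp add: field_simps)
        then have "exp 1 \<le> exp (l * x)" by simp
        moreover have "2 \<le> exp (1::real)" using exp_ge_add_one_self[of 1] by simp
        ultimately have "2 \<le> exp (l * x)" by linarith
        then show ?thesis by (simp add: exp_minus field_simps)
      qed
      then show ?case using elim l by (auto split: split_indicator)
    qed
  qed (use i in \<open>auto intro!: integrable_real_indicator simp: emeasure_eq_measure\<close>)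
  also have "\<dots> = 2 * (1 - laplace M l)" using i by (simp add: laplace_def prob_space)
  finally show ?thesis .
qed

text \<open>A point \<open>l0\<close> with \<open>L l0\<close> close to 1 takes care of all large n;
  each of the finitely many other laws has a transform tending to 1 at 0. Monotonicity in l lets one
  small l serve every n, and the tail bound turns it into one interval.\<close>

lemma laplace_limit_tight:
  assumes P: "\<And>n. nonneg_law (P n)"
    and lim: "\<And>l. 0 < l \<Longrightarrow> (\<lambda>n. laplace (P n) l) \<longlonglongrightarrow> L l"
    and L: "(L \<longlongrightarrow> 1) (at_right 0)"
  shows "tight P"
  unfolding tight_def
proof (intro conjI allI impI)
  show "real_distribution (P n)" for n using nonneg_lawD(5)[OF P] .
  fix e :: real assume e: "0 < e"
  have "eventually (\<lambda>l. 1 - e / 2 < L l \<and> 0 < l) (at_right 0)"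
    using order_tendstoD(1)[OF L, of "1 - e/2"] e eventually_at_right_less[of "0::real"]
    by (auto intro: eventually_conj)
  then obtain l0 where l0: "1 - e / 2 < L l0" "0 < l0"
    using eventually_happens' trivial_limit_at_right_real by blast
  obtain N where N: "\<And>n. N \<le> n \<Longrightarrow> 1 - e / 2 < laplace (P n) l0"
    using order_tendstoD(1)[OF lim[OF l0(2)] l0(1)] by (auto simp: eventually_sequentially)
  have "eventually (\<lambda>l. \<forall>n\<in>{..<N}. 1 - e / 2 < laplace (P n) l) (at_right 0)"
    using order_tendstoD(1)[OF laplace_tendsto_1[OF P], of "1 - e/2"] e
    by (intro eventually_ball_finite) auto
  then have "eventually (\<lambda>l. (\<forall>n\<in>{..<N}. 1 - e / 2 < laplace (P n) l) \<and> 0 < l \<and> l < l0) (at_right 0)"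
    using eventually_at_right_real[OF l0(2)] by eventually_elim auto
  then obtain l where l: "\<And>n. n < N \<Longrightarrow> 1 - e / 2 < laplace (P n) l" "0 < l" "l < l0"
    using eventually_happens' trivial_limit_at_right_real by blast
  have *: "1 - e / 2 < laplace (P n) l" for n
    using N[of n] l laplace_antimono[OF P, of l l0 n] by (cases "n < N") auto
  show "\<exists>a b. a < b \<and> (\<forall>n. 1 - e < measure (P n) {a<..b})"
  proof (intro exI conjI allI)
    \<comment> \<open>The left end lies strictly below 0 because the intervals in
      \<open>tight\<close> are open on the left and the laws may have an atom at 0.\<close>
    show "-1 < 1 / l" using l(2) by (simp add: field_simps)
    fix n
    interpret prob_space "P n" using nonneg_lawD(1)[OF P] .
    have sP[measurable_cong, simp]: "sets (P n) = sets borel" using nonneg_lawD(3)[OF P] .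
    have sp[simp]: "space (P n) = UNIV" using sets_eq_imp_space_eq[OF sP] by simp
    have "prob {..-1} \<le> prob {..<0}" by (rule finite_measure_mono) auto
    also have "prob {..<0} = 0"
      using AE_nonneg_iff[OF sP] nonneg_lawD(4)[OF P] by (simp add: measure_def)
    finally have "prob {..-1} = 0" by (simp add: measure_le_0_iff)
    have "1 = prob (({..-1} \<union> {-1<..1/l}) \<union> {1/l<..})"
    proof -
      have "({..-1} \<union> {-1<..1/l}) \<union> {1/l<..} = (UNIV::real set)"
        using \<open>-1 < 1 / l\<close> by auto
      then show ?thesis using prob_space by simp
    qed
    also have "\<dots> \<le> prob ({..-1} \<union> {-1<..1/l}) + prob {1/l<..}"
      by (rule measure_Un_le) auto
    also have "prob ({..-1} \<union> {-1<..1/l}) \<le> prob {..-1} + prob {-1<..1/l}"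
      by (rule measure_Un_le) auto
    finally have "1 \<le> prob {-1<..1/l} + prob {1/l<..}" using \<open>prob {..-1} = 0\<close> by simp
    moreover have "prob {1/l<..} < e"
      using laplace_tail_bound[OF P l(2), of n] *[of n] by simp
    ultimately show "1 - e < prob {-1<..1/l}" by linarith
  qed
qed

text \<open>Tightness yields a weak limit along a subsequence. A subsequence suffices, because the
  full sequence of transforms already converges to L.\<close>

lemma laplace_limit:
  assumes P: "\<And>n. nonneg_law (P n)"
    and lim: "\<And>l. 0 < l \<Longrightarrow> (\<lambda>n. laplace (P n) l) \<longlonglongrightarrow> L l"
    and L: "(L \<longlongrightarrow> 1) (at_right 0)"
  obtains M where "nonneg_law M" "\<And>l. 0 < l \<Longrightarrow> laplace M l = L l"
proof -
  obtain r M where r: "strict_mono r" and M: "real_distribution M" and "weak_conv_m (P \<circ> id \<circ> r) M"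
    using tight_imp_convergent_subsubsequence[OF laplace_limit_tight[OF assms], of id]
    by (auto simp: strict_mono_id)
  then have wc: "weak_conv_m (\<lambda>n. P (r n)) M" by (simp add: comp_def)
  interpret M: real_distribution M by fact
  have Pr: "real_distribution (P (r n))" for n using nonneg_lawD(5)[OF P] .
  have conv: "(\<lambda>n. integral\<^sup>L (P (r n)) h) \<longlonglongrightarrow> integral\<^sup>L M h"
    if "\<And>x. isCont h x" "\<And>x. norm (h x) \<le> 1" for h :: "real \<Rightarrow> real"
    by (rule weak_conv_imp_integral_bdd_continuous_conv[OF Pr M wc that])
  \<comment> \<open>A bounded continuous function that is positive exactly on the negative
    half-line. Its integral against M is a limit of zeros, so M does not charge negative
    numbers.\<close>
  define h where "h = (\<lambda>x::real. min 1 (max 0 (- x)))"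
  have h: "isCont h x" "norm (h x) \<le> 1" for x
    unfolding h_def by (auto intro!: continuous_intros)
  have "integral\<^sup>L (P (r n)) h = 0" for n
    by (rule integral_eq_zero_AE)
      (use nonneg_lawD(4)[OF P] in eventually_elim, simp add: h_def)
  then have "integral\<^sup>L M h = 0" using conv[OF h] by (simp add: LIMSEQ_const_iff)
  moreover have "integrable M h"
    by (rule M.integrable_const_bound[where B=1]) (use h in \<open>auto simp: h_def\<close>)
  ultimately have "AE x in M. h x = 0"
    by (subst (asm) integral_nonneg_eq_0_iff_AE) (auto simp: h_def)
  then have nn: "AE x in M. 0 \<le> x" by eventually_elim (auto simp: h_def min_def max_def split: if_splits)
  have nM: "nonneg_law M" using M nn by (simp add: nonneg_law_def)
  moreover have "laplace M l = L l" if l: "0 < l" for l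
  proof -
    \<comment> \<open>With \<open>max 0 x\<close> the integrand is bounded and continuous on the
      whole line, as weak convergence requires, and unchanged where the laws live.\<close>
    define g where "g = (\<lambda>x. exp (- (l * max 0 x)))"
    have "isCont g x" "norm (g x) \<le> 1" for x
      unfolding g_def using l by (auto intro!: continuous_intros)
    then have "(\<lambda>n. integral\<^sup>L (P (r n)) g) \<longlonglongrightarrow> integral\<^sup>L M g" by (rule conv)
    moreover have "integral\<^sup>L Q g = laplace Q l" if Q: "nonneg_law Q" for Q
    proof -
      have [measurable_cong]: "sets Q = sets borel" using nonneg_lawD(3)[OF Q] .
      show ?thesis unfolding laplace_def g_def
        by (rule integral_cong_AE)
          (measurable, rule eventually_mono[OF nonneg_lawD(4)[OF Q]], simp)
    qed
    ultimately have "(\<lambda>n. laplace (P (r n)) l) \<longlonglongrightarrow> laplace M l" using nM P by simp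
    moreover have "(\<lambda>n. laplace (P (r n)) l) \<longlonglongrightarrow> L l"
      using LIMSEQ_subseq_LIMSEQ[OF lim[OF l] r] by (simp add: comp_def)
    ultimately show ?thesis using LIMSEQ_unique by blast
  qed
  ultimately show thesis using that by blast
qed

lemma nonneg_law_return: "0 \<le> b \<Longrightarrow> nonneg_law (return borel b)"
  by (intro nonneg_lawI prob_space_return) (auto simp: AE_return)

lemma laplace_return: "laplace (return borel b) l = exp (- (l * b))"
  unfolding laplace_def by (subst integral_return) auto

lemma nonneg_law_convolution:
  assumes M: "nonneg_law M" and N: "nonneg_law N"
  shows "nonneg_law (M \<star> N)"
proof (rule nonneg_lawI)
  interpret M: prob_space M using nonneg_lawD(1)[OF M] .
  interpret N: prob_space N using nonneg_lawD(1)[OF N] .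
  interpret MN: pair_prob_space M N ..
  have sM[measurable_cong]: "sets M = sets borel" using nonneg_lawD(3)[OF M] .
  have sN[measurable_cong]: "sets N = sets borel" using nonneg_lawD(3)[OF N] .
  show "prob_space (M \<star> N)" unfolding convolution_def by (rule MN.prob_space_distr) measurable
  have "emeasure (M \<star> N) {..<0} = (\<integral>\<^sup>+x. emeasure N {a. a + x \<in> {..<0}} \<partial>M)"
    using sM sN by (intro convolution_emeasure M.finite_measure_axioms N.finite_measure_axioms)
      (auto dest!: sets_eq_imp_space_eq)
  also have "\<dots> = (\<integral>\<^sup>+x. 0 \<partial>M)"
  proof (rule nn_integral_cong_AE)
    show "AE x in M. emeasure N {a. a + x \<in> {..<0}} = 0"
      using nonneg_lawD(4)[OF M]
    proof eventually_elim
      case (elim x)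
      have "emeasure N {a. a + x \<in> {..<0}} \<le> emeasure N {..<0}"
        using elim sN by (intro emeasure_mono) auto
      then show ?case using AE_nonneg_iff[OF sN] nonneg_lawD(4)[OF N] by simp
    qed
  qed
  finally show "AE x in M \<star> N. 0 \<le> x" by (subst AE_nonneg_iff) auto
qed simp

lemma laplace_convolution:
  assumes M: "nonneg_law M" and N: "nonneg_law N" and l: "0 \<le> l"
  shows "laplace (M \<star> N) l = laplace M l * laplace N l"
proof -
  have sM[measurable_cong]: "sets M = sets borel" using nonneg_lawD(3)[OF M] .
  have sN[measurable_cong]: "sets N = sets borel" using nonneg_lawD(3)[OF N] .
  have "lap (M \<star> N) l = (\<integral>\<^sup>+x. \<integral>\<^sup>+y. ennreal (exp (- (l * (x + y)))) \<partial>N \<partial>M)"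
    unfolding lap_def using M N sM sN by (intro nn_integral_convolution) (auto dest: nonneg_lawD)
  also have "\<dots> = (\<integral>\<^sup>+x. ennreal (exp (- (l * x))) * lap N l \<partial>M)"
    unfolding lap_def
    by (intro nn_integral_cong, subst nn_integral_cmult[symmetric])
      (auto intro!: nn_integral_cong simp: ennreal_mult[symmetric] mult_exp_exp algebra_simps)
  also have "\<dots> = lap M l * lap N l"
    unfolding lap_def by (subst nn_integral_multc) auto
  finally have "ennreal (laplace (M \<star> N) l) = ennreal (laplace M l) * ennreal (laplace N l)"
    using lap_eq_laplace[OF nonneg_law_convolution[OF M N] l] lap_eq_laplace[OF M l]
      lap_eq_laplace[OF N l] by simp
  then show ?thesis
    using laplace_pos[OF M l] laplace_pos[OF N l] laplace_pos[OF nonneg_law_convolution[OF M N] l]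
    by (simp add: ennreal_mult[symmetric])
qed

section \<open>Compound Poisson and infinitely divisible laws\<close>

primrec conv_power :: "real measure \<Rightarrow> nat \<Rightarrow> real measure" where
  "conv_power M 0 = return borel 0"
| "conv_power M (Suc n) = (M \<star> conv_power M n)"

lemma nonneg_law_conv_power: "nonneg_law M \<Longrightarrow> nonneg_law (conv_power M n)"
  by (induction n) (auto intro: nonneg_law_return nonneg_law_convolution)

lemma laplace_conv_power:
  "nonneg_law M \<Longrightarrow> 0 \<le> l \<Longrightarrow> laplace (conv_power M n) l = laplace M l ^ n"
  by (induction n) (auto simp: laplace_return laplace_convolution nonneg_law_conv_power)

text \<open>N is the law of a sum of a Poisson(r) number of independent variables with law M. Mixing
  the powers of q = \<open>laplace M l\<close> with Poisson weights gives the exponential series in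
  r q.\<close>

lemma compound_poisson:
  assumes M: "nonneg_law M" and r: "0 < r"
  obtains N where "nonneg_law N" "\<And>l. 0 \<le> l \<Longrightarrow> laplace N l = exp (- (r * (1 - laplace M l)))"
proof -
  define N where "N = measure_pmf (poisson_pmf r) \<bind> conv_power M"
  have K: "conv_power M \<in> measurable (measure_pmf (poisson_pmf r)) (subprob_algebra borel)"
    unfolding measurable_pmf_measure1
    using nonneg_lawD[OF nonneg_law_conv_power[OF M]]
    by (auto simp: space_subprob_algebra intro: prob_space_imp_subprob_space)
  have sN: "sets N = sets borel" unfolding N_def by (rule sets_bind[OF sets_kernel[OF K]]) auto
  have nN: "nonneg_law N"
  proof (rule nonneg_lawI[OF _ sN])
    show "prob_space N" unfolding N_def
      by (rule measure_pmf.prob_space_bind[OF _ K]) (use nonneg_lawD[OF nonneg_law_conv_power[OF M]] in auto)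
    show "AE x in N. 0 \<le> x" unfolding N_def
      by (subst AE_bind[OF K]) (use nonneg_lawD[OF nonneg_law_conv_power[OF M]] in auto)
  qed
  moreover have "laplace N l = exp (- (r * (1 - laplace M l)))" if l: "0 \<le> l" for l
  proof -
    define q where "q = laplace M l"
    have q: "0 < q" unfolding q_def by (rule laplace_pos[OF M l])
    have sm: "(\<lambda>n. pmf (poisson_pmf r) n * q ^ n) sums exp (- (r * (1 - q)))"
    proof -
      have "(\<lambda>n. (r * q) ^ n /\<^sub>R fact n) sums exp (r * q)" by (rule exp_converges)
      then have "(\<lambda>n. exp (- r) * ((r * q) ^ n /\<^sub>R fact n)) sums (exp (- r) * exp (r * q))"
        by (rule sums_mult)
      then show ?thesis
        unfolding pmf_poisson[OF r] by (simp add: mult_exp_exp field_simps power_mult_distrib)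
    qed
    have "lap N l = (\<integral>\<^sup>+n. lap (conv_power M n) l \<partial>measure_pmf (poisson_pmf r))"
      unfolding lap_def N_def by (rule nn_integral_bind[OF _ K]) auto
    also have "\<dots> = (\<integral>\<^sup>+n. ennreal (q ^ n) \<partial>measure_pmf (poisson_pmf r))"
      using lap_eq_laplace[OF nonneg_law_conv_power[OF M] l] laplace_conv_power[OF M l]
      by (simp add: q_def)
    also have "\<dots> = (\<Sum>n. ennreal (pmf (poisson_pmf r) n * q ^ n))"
      using q by (simp add: nn_integral_measure_pmf nn_integral_count_space_nat ennreal_mult pmf_nonneg del: pmf_poisson)
    also have "\<dots> = ennreal (exp (- (r * (1 - q))))"
      using sm q by (intro suminf_ennreal_eq) (auto simp: pmf_nonneg simp del: pmf_poisson)
    finally show ?thesis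
      using lap_eq_laplace[OF nN l] laplace_pos[OF nN l] by (simp add: q_def)
  qed
  ultimately show thesis using that by blast
qed

lemma compound_poisson_finite:
  assumes "finite_measure \<eta>" and sE[measurable_cong]: "sets \<eta> = sets borel" and nn: "AE x in \<eta>. 0 \<le> x"
  obtains N where "nonneg_law N"
    "\<And>l. 0 \<le> l \<Longrightarrow> laplace N l = exp (- (\<integral>x. 1 - exp (- (l * x)) \<partial>\<eta>))"
proof -
  interpret finite_measure \<eta> by fact
  define r where "r = measure \<eta> (space \<eta>)"
  have spE: "space \<eta> = UNIV" using sets_eq_imp_space_eq[OF sE] by simp
  show thesis
  proof (cases "r = 0")
    case True
    then have "emeasure \<eta> (space \<eta>) = 0" by (simp add: r_def emeasure_eq_measure)
    then have "AE x in \<eta>. P x" for P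
      by (intro AE_I[of _ _ "space \<eta>"]) auto
    then have "(\<integral>x. 1 - exp (- (l * x)) \<partial>\<eta>) = 0" for l by (intro integral_eq_zero_AE)
    then show thesis
      using that[of "return borel 0"] nonneg_law_return[of 0] laplace_return[of 0] by simp
  next
    case False
    then have r: "0 < r" unfolding r_def by (simp add: zero_less_measure_iff)
    define M where "M = density \<eta> (\<lambda>x. ennreal (1 / r))"
    have M: "nonneg_law M"
    proof (rule nonneg_lawI)
      show "prob_space M"
      proof
        show "emeasure M (space M) = 1"
          using r by (auto simp: M_def emeasure_density emeasure_eq_measure r_def ennreal_mult[symmetric])
      qed
      show "AE x in M. 0 \<le> x" unfolding M_def using nn by (simp add: AE_density)
    qed (simp add: M_def sE)
    have lM: "r * (1 - laplace M l) = (\<integral>x. 1 - exp (- (l * x)) \<partial>\<eta>)" if "0 \<le> l" for l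
    proof -
      have "laplace M l = (\<integral>x. (1 / r) * exp (- (l * x)) \<partial>\<eta>)"
        unfolding laplace_def M_def using r by (subst integral_density) auto
      also have "\<dots> = (1 / r) * (\<integral>x. exp (- (l * x)) \<partial>\<eta>)" by simp
      finally show ?thesis
        using r lap_integrable[OF assms that] by (simp add: r_def field_simps)
    qed
    obtain N where "nonneg_law N" "\<And>l. 0 \<le> l \<Longrightarrow> laplace N l = exp (- (r * (1 - laplace M l)))"
      using compound_poisson[OF M r] by blast
    then show thesis using that[of N] lM by simp
  qed
qed

text \<open>\<eta> may have infinite mass near 0. Keeping only the jumps larger than 1 / (k + 1)
  leaves finite measures and hence compound Poisson laws; their exponents converge by domination,
  and the continuity theorem supplies the limit law.\<close>

lemma infinitely_divisible_law:
  assumes sE[measurable_cong]: "sets \<eta> = sets borel" and nn: "AE x in \<eta>. 0 \<le> x"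
    and int: "\<And>l. 0 < l \<Longrightarrow> integrable \<eta> (\<lambda>x. 1 - exp (- (l * x)))"
  obtains N where "nonneg_law N"
    "\<And>l. 0 < l \<Longrightarrow> laplace N l = exp (- (\<integral>x. 1 - exp (- (l * x)) \<partial>\<eta>))"
proof -
  define E where "E k = density \<eta> (indicator {1 / real (Suc k)<..})" for k
  have sEk: "sets (E k) = sets borel" for k by (simp add: E_def sE)
  have nnE: "AE x in E k. 0 \<le> x" for k unfolding E_def using nn by (subst AE_density) (auto elim: eventually_mono)
  have fE: "finite_measure (E k)" for k
  proof
    \<comment> \<open>A lower bound of 1 - exp (- x) on the jumps that are kept, so integrability of
      that function bounds their mass.\<close>
    define d where "d = 1 - exp (- (1 / real (Suc k)))"
    have d: "0 < d" by (simp add: d_def)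
    have "emeasure (E k) (space (E k)) = (\<integral>\<^sup>+x. indicator {1 / real (Suc k)<..} x \<partial>\<eta>)"
      by (subst nn_integral_indicator) (auto simp: E_def emeasure_density sets_eq_imp_space_eq[OF sE])
    also have "\<dots> \<le> (\<integral>\<^sup>+x. ennreal (1 / d) * ennreal (1 - exp (- (1 * x))) \<partial>\<eta>)"
    proof (rule nn_integral_mono_AE)
      show "AE x in \<eta>. indicator {1 / real (Suc k)<..} x \<le> ennreal (1 / d) * ennreal (1 - exp (- (1 * x)))"
        using nn
      proof eventually_elim
        case (elim x)
        have "1 \<le> 1 / d * (1 - exp (- x))" if "1 / real (Suc k) < x"
          using that d by (simp add: field_simps d_def)
        then show ?case using elim d by (auto simp: ennreal_mult[symmetric] split: split_indicator)
      qed
    qed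
    also have "\<dots> = ennreal (1 / d) * (\<integral>\<^sup>+x. ennreal (1 - exp (- (1 * x))) \<partial>\<eta>)"
      by (rule nn_integral_cmult) auto
    also have "\<dots> < \<infinity>"
    proof -
      have "(\<integral>\<^sup>+x. ennreal (1 - exp (- (1 * x))) \<partial>\<eta>) \<le> (\<integral>\<^sup>+x. ennreal (norm (1 - exp (- (1 * x)))) \<partial>\<eta>)"
        by (intro nn_integral_mono) auto
      also have "\<dots> < \<infinity>" using int[of 1] by (simp add: integrable_iff_bounded)
      finally show ?thesis by (simp add: ennreal_mult_less_top)
    qed
    finally show "emeasure (E k) (space (E k)) \<noteq> \<infinity>" by simp
  qed
  define A where "A l = (\<integral>x. 1 - exp (- (l * x)) \<partial>\<eta>)" for l
  have "\<exists>N. nonneg_law N \<and> (\<forall>l\<ge>0. laplace N l = exp (- (\<integral>x. 1 - exp (- (l * x)) \<partial>E k)))" for k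
    by (rule compound_poisson_finite[OF fE[of k] sEk nnE], rule exI, rule conjI, assumption, simp)
  then have "\<forall>k. \<exists>N. nonneg_law N \<and> (\<forall>l\<ge>0. laplace N l = exp (- (\<integral>x. 1 - exp (- (l * x)) \<partial>E k)))"
    by (rule allI)
  from choice[OF this] obtain P where P: "\<And>k. nonneg_law (P k)"
    "\<And>k l. 0 \<le> l \<Longrightarrow> laplace (P k) l = exp (- (\<integral>x. 1 - exp (- (l * x)) \<partial>E k))"
    by blast
  have "(\<lambda>k. laplace (P k) l) \<longlonglongrightarrow> exp (- A l)" if l: "0 < l" for l
  proof -
    have "(\<lambda>k. \<integral>x. indicator {1 / real (Suc k)<..} x *\<^sub>R (1 - exp (- (l * x))) \<partial>\<eta>) \<longlonglongrightarrow> A l"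
      unfolding A_def
    proof (rule integral_dominated_convergence[where w="\<lambda>x. \<bar>1 - exp (- (l * x))\<bar>"])
      show "AE x in \<eta>. (\<lambda>k. indicator {1 / real (Suc k)<..} x *\<^sub>R (1 - exp (- (l * x)))) \<longlonglongrightarrow> 1 - exp (- (l * x))"
        using nn
      proof eventually_elim
        case (elim x)
        show ?case
        proof (cases "x = 0")
          case False
          then have "0 < x" using elim by simp
          then have "eventually (\<lambda>k. 1 / real (Suc k) < x) sequentially" by real_asymp
          then have "eventually (\<lambda>k. indicator {1 / real (Suc k)<..} x *\<^sub>R (1 - exp (- (l * x))) = 1 - exp (- (l * x))) sequentially"
            by eventually_elim auto
          then show ?thesis by (rule tendsto_eventually)
        qed simp
      qed
      show "integrable \<eta> (\<lambda>x. \<bar>1 - exp (- (l * x))\<bar>)" using int[OF l] by (rule integrable_abs)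
    qed (auto split: split_indicator)
    moreover have "(\<integral>x. indicator {1 / real (Suc k)<..} x *\<^sub>R (1 - exp (- (l * x))) \<partial>\<eta>) = (\<integral>x. 1 - exp (- (l * x)) \<partial>E k)" for k
    proof -
      have "E k = density \<eta> (\<lambda>x. ennreal (indicator {1 / real (Suc k)<..} x))"
        unfolding E_def by (intro density_cong) (auto simp: ennreal_indicator)
      then show ?thesis by (simp add: integral_density)
    qed
    ultimately show ?thesis using P(2)[of l] l by (simp add: tendsto_exp tendsto_minus)
  qed
  moreover have "((\<lambda>l. exp (- A l)) \<longlongrightarrow> 1) (at_right 0)"
  proof -
    have "(A \<longlongrightarrow> 0) (at_right 0)"
      unfolding tendsto_at_iff_sequentially
    proof (intro allI impI)
      fix X :: "nat \<Rightarrow> real" assume X: "\<forall>i. X i \<in> {0<..} - {0}" "X \<longlonglongrightarrow> 0"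
      \<comment> \<open>Once \<open>X n < 1\<close>, monotonicity in l makes the integrand at l = 1
        a dominating function.\<close>
      obtain n0 where n0: "\<And>n. n0 \<le> n \<Longrightarrow> X n < 1"
        using order_tendstoD(2)[OF X(2), of 1] by (auto simp: eventually_sequentially)
      have "(\<lambda>n. A (X (n + n0))) \<longlonglongrightarrow> (\<integral>x. 0 \<partial>\<eta>)"
        unfolding A_def
      proof (rule integral_dominated_convergence[where w="\<lambda>x. 1 - exp (- (1 * x))"])
        show "AE x in \<eta>. (\<lambda>n. 1 - exp (- (X (n + n0) * x))) \<longlonglongrightarrow> 0"
        proof (rule AE_I2)
          fix x
          have "(\<lambda>n. 1 - exp (- (X (n + n0) * x))) \<longlonglongrightarrow> 1 - exp (- (0 * x))"
            by (intro tendsto_intros LIMSEQ_ignore_initial_segment X)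
          then show "(\<lambda>n. 1 - exp (- (X (n + n0) * x))) \<longlonglongrightarrow> 0" by simp
        qed
        show "AE x in \<eta>. norm (1 - exp (- (X (n + n0) * x))) \<le> 1 - exp (- (1 * x))" for n
          using nn
        proof eventually_elim
          case (elim x)
          have "X (n + n0) * x \<le> 1 * x" using n0[of "n + n0"] elim by (intro mult_right_mono) auto
          moreover have "0 \<le> X (n + n0) * x" using elim X(1) by (auto simp: less_imp_le)
          ultimately show ?case by auto
        qed
      qed (use int[of 1] in auto)
      then have "(\<lambda>n. (A \<circ> X) (n + n0)) \<longlonglongrightarrow> 0" by simp
      then show "(A \<circ> X) \<longlonglongrightarrow> 0" by (rule LIMSEQ_offset)
    qed
    then have "((\<lambda>l. exp (- A l)) \<longlongrightarrow> exp (- 0)) (at_right 0)" by (intro tendsto_intros)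
    then show ?thesis by simp
  qed
  ultimately show thesis
    by (rule laplace_limit[OF P(1), where L="\<lambda>l. exp (- A l)"]) (assumption, rule that, auto simp: A_def)
qed

section \<open>Derivatives of Laplace transforms\<close>

text \<open>For l > 0 this is - \<phi>'(l), with \<phi> the transform of M.\<close>

definition laplace_moment :: "real measure \<Rightarrow> real \<Rightarrow> real" where
  "laplace_moment M l = (\<integral>x. x * exp (- (l * x)) \<partial>M)"

text \<open>A mean value estimate. The common lower bound \<open>m\<close> of the exponents
  preserves exponential decay, so that difference quotients in l can be dominated uniformly.\<close>

lemma abs_exp_diff_le:
  fixes u v m :: real
  assumes "m \<le> u" "m \<le> v"
  shows "\<bar>exp (- u) - exp (- v)\<bar> \<le> \<bar>u - v\<bar> * exp (- m)"
proof -
  have *: "exp (- u) - exp (- v) \<le> (v - u) * exp (- m)" if "m \<le> u" "u \<le> v" for u v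
  proof -
    have "exp (- u) - exp (- v) = exp (- u) * (1 - exp (- (v - u)))"
      by (simp add: right_diff_distrib mult_exp_exp)
    also have "\<dots> \<le> exp (- u) * (v - u)"
    proof (rule mult_left_mono)
      have "1 + - (v - u) \<le> exp (- (v - u))" by (rule exp_ge_add_one_self)
      then show "1 - exp (- (v - u)) \<le> v - u" by linarith
    qed simp
    also have "\<dots> \<le> exp (- m) * (v - u)" using that by (intro mult_right_mono) auto
    finally show ?thesis by (simp add: mult.commute)
  qed
  show ?thesis
  proof (cases "u \<le> v")
    case True
    then show ?thesis using *[of u v] assms by simp
  next
    case False
    then show ?thesis using *[of v u] assms by simp
  qed
qed

text \<open>Differentiation under the integral sign. M may have infinite mass, so that the result
  also applies to x M(dx), which is how continuity of \<open>laplace_moment\<close> is obtained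
  below.\<close>

lemma
  assumes sM[measurable_cong]: "sets M = sets borel" and nn: "AE x in M. 0 \<le> x"
    and int: "\<And>l. 0 < l \<Longrightarrow> integrable M (\<lambda>x. exp (- (l * x)))"
    and l: "0 < l"
  shows integrable_laplace_moment: "integrable M (\<lambda>x. x * exp (- (l * x)))"
    and DERIV_laplace': "(laplace M has_real_derivative - laplace_moment M l) (at l)"
proof -
  have im: "integrable M (\<lambda>x. x * exp (- (l * x)))" if l: "0 < l" for l
  proof (rule Bochner_Integration.integrable_bound)
    \<comment> \<open>Half of the decay is spent on absorbing the factor x, by x \<le> (2 / l) exp
      (l x / 2).\<close>
    show "integrable M (\<lambda>x. (2 / l) * exp (- (l / 2 * x)))" using int[of "l / 2"] l by simp
    show "AE x in M. norm (x * exp (- (l * x))) \<le> norm ((2 / l) * exp (- (l / 2 * x)))"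
      using nn
    proof eventually_elim
      case (elim x)
      have "l / 2 * x \<le> exp (l / 2 * x)" using exp_ge_add_one_self[of "l / 2 * x"] by linarith
      then have "x * exp (- (l * x)) \<le> (2 / l * exp (l / 2 * x)) * exp (- (l * x))"
        using l by (intro mult_right_mono) (auto simp: field_simps)
      also have "\<dots> = (2 / l) * exp (- (l / 2 * x))"
        by (simp add: mult.assoc mult_exp_exp)
      finally show ?case using elim l by simp
    qed
  qed measurable
  show "integrable M (\<lambda>x. x * exp (- (l * x)))" by (rule im[OF l])
  have D: "((\<lambda>h. exp (- (h * x))) has_real_derivative - (x * exp (- (l * x)))) (at l)" for x :: real
    by (auto intro!: derivative_eq_intros)
  show "(laplace M has_real_derivative - laplace_moment M l) (at l)"
    unfolding has_field_derivative_iff tendsto_at_iff_sequentially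
  proof (intro allI impI)
    fix X :: "nat \<Rightarrow> real" assume X: "\<forall>i. X i \<in> UNIV - {l}" "X \<longlonglongrightarrow> l"
    obtain n0 where n0: "\<And>n. n0 \<le> n \<Longrightarrow> l / 2 < X n"
      using order_tendstoD(1)[OF X(2), of "l/2"] l by (auto simp: eventually_sequentially)
    have "(\<lambda>n. \<integral>x. (exp (- (X (n + n0) * x)) - exp (- (l * x))) / (X (n + n0) - l) \<partial>M)
       \<longlonglongrightarrow> (\<integral>x. - (x * exp (- (l * x))) \<partial>M)"
    proof (rule integral_dominated_convergence[where w="\<lambda>x. x * exp (- (l / 2 * x))"])
      show "AE x in M. (\<lambda>n. (exp (- (X (n + n0) * x)) - exp (- (l * x))) / (X (n + n0) - l))
          \<longlonglongrightarrow> - (x * exp (- (l * x)))"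
      proof (rule AE_I2)
        fix x
        have "((\<lambda>y. (exp (- (y * x)) - exp (- (l * x))) / (y - l)) \<circ> X) \<longlonglongrightarrow> - (x * exp (- (l * x)))"
          using D[of x] X unfolding has_field_derivative_iff tendsto_at_iff_sequentially by blast
        from LIMSEQ_ignore_initial_segment[OF this, of n0]
        show "(\<lambda>n. (exp (- (X (n + n0) * x)) - exp (- (l * x))) / (X (n + n0) - l))
          \<longlonglongrightarrow> - (x * exp (- (l * x)))" by (simp add: comp_def)
      qed
      show "AE x in M. norm ((exp (- (X (n + n0) * x)) - exp (- (l * x))) / (X (n + n0) - l)) \<le> x * exp (- (l / 2 * x))" for n
        using nn
      proof eventually_elim
        case (elim x)
        define y where "y = X (n + n0)"
        have y: "l / 2 < y" "y \<noteq> l" using n0[of "n + n0"] X(1) by (auto simp: y_def)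
        have "\<bar>exp (- (y * x)) - exp (- (l * x))\<bar> \<le> \<bar>y * x - l * x\<bar> * exp (- (l / 2 * x))"
          using y elim l by (intro abs_exp_diff_le mult_right_mono) auto
        also have "\<bar>y * x - l * x\<bar> = x * \<bar>y - l\<bar>"
          using elim by (simp add: left_diff_distrib[symmetric] abs_mult)
        finally have "\<bar>exp (- (y * x)) - exp (- (l * x))\<bar> / \<bar>y - l\<bar> \<le> x * exp (- (l / 2 * x))"
          using y by (simp add: field_simps)
        then show ?case by (simp add: y_def abs_divide)
      qed
    qed (use im[of "l/2"] l in auto)
    also have "(\<lambda>n. \<integral>x. (exp (- (X (n + n0) * x)) - exp (- (l * x))) / (X (n + n0) - l) \<partial>M)
      = (\<lambda>n. ((\<lambda>y. (laplace M y - laplace M l) / (y - l)) \<circ> X) (n + n0))"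
    proof
      fix n
      show "(\<integral>x. (exp (- (X (n + n0) * x)) - exp (- (l * x))) / (X (n + n0) - l) \<partial>M)
      = ((\<lambda>y. (laplace M y - laplace M l) / (y - l)) \<circ> X) (n + n0)"
        using int[OF l] int[of "X (n + n0)"] n0[of "n + n0"] l
        by (simp add: laplace_def)
    qed
    also have "(\<integral>x. - (x * exp (- (l * x))) \<partial>M) = - laplace_moment M l"
      by (simp add: laplace_moment_def)
    finally have "(\<lambda>n. ((\<lambda>y. (laplace M y - laplace M l) / (y - l)) \<circ> X) (n + n0)) \<longlonglongrightarrow> - laplace_moment M l" .
    then show "((\<lambda>y. (laplace M y - laplace M l) / (y - l)) \<circ> X) \<longlonglongrightarrow> - laplace_moment M l"
      by (rule LIMSEQ_offset)
  qed
qed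

lemma
  assumes M: "nonneg_law M" and l: "0 < l"
  shows laplace_moment_integrable: "integrable M (\<lambda>x. x * exp (- (l * x)))"
    and DERIV_laplace: "(laplace M has_real_derivative - laplace_moment M l) (at l)"
    and isCont_laplace_moment: "isCont (laplace_moment M) l"
proof -
  note N = nonneg_lawD(3,4)[OF M]
  have [measurable_cong]: "sets M = sets borel" by fact
  have int: "integrable M (\<lambda>x. exp (- (l * x)))" if "0 < l" for l
    using laplace_integrable[OF M] that by simp
  show "(laplace M has_real_derivative - laplace_moment M l) (at l)"
    by (rule DERIV_laplace'[OF N int l])
  have im: "integrable M (\<lambda>x. x * exp (- (l * x)))" if "0 < l" for l
    by (rule integrable_laplace_moment[OF N int that])
  show "integrable M (\<lambda>x. x * exp (- (l * x)))" by (rule im[OF l])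
  \<comment> \<open>The transform of x M(dx) is \<open>laplace_moment M\<close>, so continuity of
    the latter follows from differentiability of a transform.\<close>
  define M' where "M' = density M (\<lambda>x. ennreal (max 0 x))"
  have eqAE: "AE x in M. max 0 x *\<^sub>R exp (- (l * x)) = x * exp (- (l * x))" for l
    using N(2) by eventually_elim simp
  have int': "integrable M' (\<lambda>x. exp (- (l * x)))" if "0 < l" for l
    unfolding M'_def using im[OF that] eqAE[of l]
    by (subst integrable_density) (auto elim!: integrable_cong_AE_imp)
  have "laplace M' l = laplace_moment M l" for l
    unfolding laplace_def laplace_moment_def M'_def using eqAE[of l]
    by (subst integral_density) (auto intro!: integral_cong_AE)
  then have "laplace M' = laplace_moment M" by auto
  moreover have sM': "sets M' = sets borel" using N(1) by (simp add: M'_def)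
  moreover have nM': "AE x in M'. 0 \<le> x"
    unfolding M'_def using N(2) by (subst AE_density) (auto elim: eventually_mono)
  have "isCont (laplace M') l"
    by (rule DERIV_isCont[OF DERIV_laplace'[OF sM' nM' int' l]])
  ultimately show "isCont (laplace_moment M) l" by simp
qed

section \<open>Comparison of the Levy integrability condition with Laplace exponents\<close>

text \<open>From exp (- x) \<le> 1 / (1 + x) one gets 1 - exp (- x) \<ge> x / (1 + x), which is at
  least half of min 1 x.\<close>

lemma one_minus_exp_ge_min: "0 \<le> x \<Longrightarrow> min 1 x \<le> 2 * (1 - exp (- x))" for x :: real
proof -
  assume x: "0 \<le> x"
  have "exp (- x) \<le> 1 / (1 + x)"
    using exp_ge_add_one_self[of x] x by (simp add: exp_minus field_simps)
  also have "\<dots> \<le> 1 - min 1 x / 2"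
  proof (cases "x \<le> 1")
    case True
    then have "x * x \<le> x * 1" using x by (intro mult_left_mono)
    then show ?thesis using x True by (simp add: field_simps)
  next
    case False
    then show ?thesis using x by (simp add: field_simps)
  qed
  finally show ?thesis by simp
qed

text \<open>For l \<ge> 1 the constant is l itself, so after division by l the bound min 1 x is
  uniform; the limit of K(l) / l at infinity rests on this.\<close>

lemma one_minus_exp_le_min:
  fixes x l :: real
  assumes "0 \<le> x" "0 < l"
  shows "1 - exp (- (l * x)) \<le> max 1 l * min 1 x"
proof -
  have "1 - exp (- (l * x)) \<le> l * x" using exp_ge_add_one_self[of "- (l * x)"] by simp
  also have "\<dots> \<le> max 1 l * x" using assms by (intro mult_right_mono) auto
  finally have "1 - exp (- (l * x)) \<le> max 1 l * x" .
  moreover have "1 - exp (- (l * x)) \<le> max 1 l * 1" using exp_gt_zero[of "- (l * x)"] by linarith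
  ultimately show ?thesis by (simp add: min_def)
qed

lemma nn_integral_exp_Icc:
  assumes "0 < l"
  shows "(\<integral>\<^sup>+x. ennreal (exp (- (l * x))) * indicator {0<..<y} x \<partial>lborel) = ennreal (1 / l) * ennreal (1 - exp (- (l * y)))"
proof (cases "0 \<le> y")
  case True
  have "(\<integral>\<^sup>+x. ennreal (exp (- (l * x))) * indicator {0<..<y} x \<partial>lborel)
      = (\<integral>\<^sup>+x. ennreal (exp (- (l * x))) * indicator {0..y} x \<partial>lborel)"
    by (rule nn_integral_cong_AE)
      (use AE_lborel_singleton[of 0] AE_lborel_singleton[of y] in
        eventually_elim, auto split: split_indicator)
  also have "\<dots> = ennreal (- (exp (- (l * y)) / l) - (- (exp (- (l * 0)) / l)))"
    using True assms by (intro nn_integral_FTC_Icc) (auto intro!: derivative_eq_intros)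
  also have "\<dots> = ennreal (1 / l * (1 - exp (- (l * y))))" by (simp add: right_diff_distrib)
  also have "\<dots> = ennreal (1 / l) * ennreal (1 - exp (- (l * y)))"
    using assms True by (intro ennreal_mult) auto
  finally show ?thesis .
next
  case False
  then have "1 - exp (- (l * y)) \<le> 0" using assms by (simp add: mult_pos_neg less_imp_le)
  then have "ennreal (1 - exp (- (l * y))) = 0" by (rule ennreal_neg)
  moreover have "{0<..<y} = {}" using False by auto
  ultimately show ?thesis by simp
qed

section \<open>Levy measures of subordinators\<close>

text \<open>The cut-off makes a convolution with \<open>tail \<nu>\<close> over the whole line run
  over s < t only, and keeps the values finite: the mass of (0, \<infinity>) itself may be
  infinite.\<close>

definition tail :: "real measure \<Rightarrow> real \<Rightarrow> ennreal" where
  "tail \<nu> x = indicator {0<..} x * emeasure \<nu> {x<..}"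

text \<open>The function K of the overview: the Laplace exponent of the driftless subordinator with
  jump measure \<nu>.\<close>

definition bernstein :: "real measure \<Rightarrow> real \<Rightarrow> ennreal" where
  "bernstein \<nu> l = (\<integral>\<^sup>+x. ennreal (1 - exp (- (l * x))) \<partial>\<nu>)"

context
  fixes \<nu> :: "real measure"
  assumes levy: "subordinator_levy_measure \<nu>"
begin

lemma levy_sets: "sets \<nu> = sets borel"
  using levy by (simp add: subordinator_levy_measure_def)

context
  notes [measurable_cong] = levy_sets
begin

lemma levy_space: "space \<nu> = UNIV"
  using sets_eq_imp_space_eq[OF levy_sets] by simp

lemma levy_AE_pos: "AE x in \<nu>. 0 < x"
  using levy by (subst AE_iff_measurable[of "{..0}"])
    (auto simp: subordinator_levy_measure_def levy_space levy_sets)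

lemma levy_min_finite: "(\<integral>\<^sup>+x. ennreal (min 1 x) \<partial>\<nu>) < \<infinity>"
proof -
  have "(\<integral>\<^sup>+x. ennreal (min 1 x) \<partial>\<nu>) = (\<integral>\<^sup>+x\<in>{0<..}. ennreal (min 1 x) \<partial>\<nu>)"
    by (rule nn_integral_cong) (auto simp: min_def ennreal_neg split: split_indicator)
  then show ?thesis using levy by (simp add: subordinator_levy_measure_def)
qed

lemma levy_tail_finite: "0 < x \<Longrightarrow> emeasure \<nu> {x<..} < \<infinity>"
proof -
  assume x: "0 < x"
  have "emeasure \<nu> {x<..} = (\<integral>\<^sup>+y. indicator {x<..} y \<partial>\<nu>)" by (simp add: levy_sets)
  also have "\<dots> \<le> (\<integral>\<^sup>+y. ennreal (1 / min 1 x) * ennreal (min 1 y) \<partial>\<nu>)"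
  proof (rule nn_integral_mono)
    fix y
    have "1 \<le> 1 / min 1 x * min 1 y" if "x < y" using that x by (simp add: field_simps min_def)
    then show "indicator {x<..} y \<le> ennreal (1 / min 1 x) * ennreal (min 1 y)"
      using x by (auto simp: ennreal_mult[symmetric] split: split_indicator)
  qed
  also have "\<dots> = ennreal (1 / min 1 x) * (\<integral>\<^sup>+y. ennreal (min 1 y) \<partial>\<nu>)"
    by (rule nn_integral_cmult) measurable
  also have "\<dots> < \<infinity>" using levy_min_finite by (simp add: ennreal_mult_less_top)
  finally show ?thesis .
qed

lemma levy_sigma_finite: "sigma_finite_measure \<nu>"
proof
  have "countable (insert {..0} (range (\<lambda>n. {1 / real (Suc n)<..})))" by auto
  moreover have "x \<in> \<Union> (insert {..0} (range (\<lambda>n. {1 / real (Suc n)<..})))" for x :: real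
  proof (cases "x \<le> 0")
    case False
    then obtain n where "inverse (real (Suc n)) < x" using reals_Archimedean[of x] by auto
    then show ?thesis by (auto simp: inverse_eq_divide)
  qed auto
  then have "\<Union> (insert {..0} (range (\<lambda>n. {1 / real (Suc n)<..}))) = space \<nu>" by (auto simp: levy_space)
  moreover have "emeasure \<nu> S \<noteq> \<infinity>" if "S \<in> insert {..0} (range (\<lambda>n. {1 / real (Suc n)<..}))" for S
    using that levy levy_tail_finite[of "1 / real (Suc n)" for n]
    by (auto simp: subordinator_levy_measure_def less_top[symmetric])
  ultimately show "\<exists>A. countable A \<and> A \<subseteq> sets \<nu> \<and> \<Union> A = space \<nu> \<and> (\<forall>a\<in>A. emeasure \<nu> a \<noteq> \<infinity>)"
    by (intro exI[of _ "insert {..0} (range (\<lambda>n. {1 / real (Suc n)<..}))"]) (auto simp: levy_sets)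
qed

text \<open>With a jointly measurable integrand, the tail becomes a parameter integral: this gives
  its measurability and allows the order of integration to be exchanged.\<close>

lemma tail_eq_nn_integral: "tail \<nu> x = (\<integral>\<^sup>+y. (if 0 < x \<and> x < y then 1 else 0) \<partial>\<nu>)"
proof -
  have "(\<integral>\<^sup>+y. (if 0 < x \<and> x < y then 1 else 0) \<partial>\<nu>) = (\<integral>\<^sup>+y. indicator {0<..} x * indicator {x<..} y \<partial>\<nu>)"
    by (rule nn_integral_cong) (auto split: split_indicator)
  also have "\<dots> = indicator {0<..} x * emeasure \<nu> {x<..}"
    by (subst nn_integral_cmult_indicator) (auto simp: levy_sets)
  finally show ?thesis by (simp add: tail_def)
qed

lemma borel_measurable_tail[measurable]: "tail \<nu> \<in> borel_measurable borel"
proof -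
  interpret sigma_finite_measure \<nu> by (rule levy_sigma_finite)
  have "(\<lambda>x. \<integral>\<^sup>+y. (if 0 < x \<and> x < y then 1 else 0) \<partial>\<nu>) \<in> borel_measurable borel" by measurable
  then show ?thesis by (subst (asm) tail_eq_nn_integral[symmetric]) simp
qed

lemma tail_finite: "tail \<nu> x < \<infinity>"
  using levy_tail_finite[of x] by (auto simp: tail_def split: split_indicator)

lemma bernstein_finite:
  assumes "0 < l"
  shows "bernstein \<nu> l < \<infinity>"
proof -
  have "bernstein \<nu> l \<le> (\<integral>\<^sup>+x. ennreal (max 1 l) * ennreal (min 1 x) \<partial>\<nu>)"
    unfolding bernstein_def
  proof (rule nn_integral_mono_AE)
    show "AE x in \<nu>. ennreal (1 - exp (- (l * x))) \<le> ennreal (max 1 l) * ennreal (min 1 x)"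
      using levy_AE_pos
      by eventually_elim (use one_minus_exp_le_min[OF _ assms] in \<open>auto simp: ennreal_mult[symmetric] intro!: ennreal_leI\<close>)
  qed
  also have "\<dots> = ennreal (max 1 l) * (\<integral>\<^sup>+x. ennreal (min 1 x) \<partial>\<nu>)"
    by (rule nn_integral_cmult) measurable
  also have "\<dots> < \<infinity>" using levy_min_finite by (simp add: ennreal_mult_less_top)
  finally show ?thesis .
qed

text \<open>By Tonelli, a jump of size y contributes the integral of exp (- l x) over 0 < x < y,
  which is (1 - exp (- l y)) / l.\<close>

lemma nn_integral_exp_tail:
  assumes l: "0 < l"
  shows "(\<integral>\<^sup>+x. ennreal (exp (- (l * x))) * tail \<nu> x \<partial>lborel) = ennreal (1 / l) * bernstein \<nu> l"
proof -
  interpret sigma_finite_measure \<nu> by (rule levy_sigma_finite)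
  interpret pair_sigma_finite lborel \<nu> ..
  have "(\<integral>\<^sup>+x. ennreal (exp (- (l * x))) * tail \<nu> x \<partial>lborel)
      = (\<integral>\<^sup>+x. \<integral>\<^sup>+y. ennreal (exp (- (l * x))) * (if 0 < x \<and> x < y then 1 else 0) \<partial>\<nu> \<partial>lborel)"
    unfolding tail_eq_nn_integral by (intro nn_integral_cong nn_integral_cmult[symmetric]) measurable
  also have "\<dots> = (\<integral>\<^sup>+y. \<integral>\<^sup>+x. ennreal (exp (- (l * x))) * (if 0 < x \<and> x < y then 1 else 0) \<partial>lborel \<partial>\<nu>)"
    by (rule Fubini'[symmetric]) measurable
  also have "\<dots> = (\<integral>\<^sup>+y. \<integral>\<^sup>+x. ennreal (exp (- (l * x))) * indicator {0<..<y} x \<partial>lborel \<partial>\<nu>)"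
    by (intro nn_integral_cong) (auto split: split_indicator)
  also have "\<dots> = ennreal (1 / l) * bernstein \<nu> l"
    unfolding nn_integral_exp_Icc[OF l] bernstein_def by (rule nn_integral_cmult) measurable
  finally show ?thesis .
qed

end

end

lemma nn_integral_exp_convolution:
  fixes f g :: "real \<Rightarrow> ennreal"
  assumes [measurable]: "f \<in> borel_measurable borel" "g \<in> borel_measurable borel"
  shows "(\<integral>\<^sup>+t. ennreal (exp (- (l * t))) * (\<integral>\<^sup>+s. g (t - s) * f s \<partial>lborel) \<partial>lborel)
    = (\<integral>\<^sup>+x. ennreal (exp (- (l * x))) * g x \<partial>lborel) * (\<integral>\<^sup>+s. ennreal (exp (- (l * s))) * f s \<partial>lborel)"
proof -
  have "(\<integral>\<^sup>+t. ennreal (exp (- (l * t))) * (\<integral>\<^sup>+s. g (t - s) * f s \<partial>lborel) \<partial>lborel)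
    = (\<integral>\<^sup>+t. \<integral>\<^sup>+s. ennreal (exp (- (l * t))) * (g (t - s) * f s) \<partial>lborel \<partial>lborel)"
    by (intro nn_integral_cong nn_integral_cmult[symmetric]) auto
  also have "\<dots> = (\<integral>\<^sup>+s. \<integral>\<^sup>+t. ennreal (exp (- (l * t))) * (g (t - s) * f s) \<partial>lborel \<partial>lborel)"
    by (rule lborel_pair.Fubini'[symmetric]) (simp add: split_beta')
  also have "\<dots> = (\<integral>\<^sup>+s. (\<integral>\<^sup>+x. ennreal (exp (- (l * x))) * g x \<partial>lborel) * (ennreal (exp (- (l * s))) * f s) \<partial>lborel)"
  proof (rule nn_integral_cong)
    fix s
    have "(\<integral>\<^sup>+t. ennreal (exp (- (l * t))) * (g (t - s) * f s) \<partial>lborel)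
        = (\<integral>\<^sup>+x. ennreal (exp (- (l * (s + 1 * x)))) * (g (s + 1 * x - s) * f s) \<partial>lborel)"
      by (subst nn_integral_real_affine[where c=1 and t=s]) auto
    also have "\<dots> = (\<integral>\<^sup>+x. ennreal (exp (- (l * x))) * g x * (ennreal (exp (- (l * s))) * f s) \<partial>lborel)"
    proof (rule nn_integral_cong)
      fix x
      have "ennreal (exp (- (l * (s + 1 * x)))) = ennreal (exp (- (l * x))) * ennreal (exp (- (l * s)))"
        by (simp add: ennreal_mult[symmetric] mult_exp_exp algebra_simps)
      then show "ennreal (exp (- (l * (s + 1 * x)))) * (g (s + 1 * x - s) * f s) =
          ennreal (exp (- (l * x))) * g x * (ennreal (exp (- (l * s))) * f s)" by (simp add: ac_simps)
    qed
    also have "\<dots> = (\<integral>\<^sup>+x. ennreal (exp (- (l * x))) * g x \<partial>lborel) * (ennreal (exp (- (l * s))) * f s)"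
      by (rule nn_integral_multc) measurable
    finally show "(\<integral>\<^sup>+t. ennreal (exp (- (l * t))) * (g (t - s) * f s) \<partial>lborel)
      = (\<integral>\<^sup>+x. ennreal (exp (- (l * x))) * g x \<partial>lborel) * (ennreal (exp (- (l * s))) * f s)" .
  qed
  also have "\<dots> = (\<integral>\<^sup>+x. ennreal (exp (- (l * x))) * g x \<partial>lborel) * (\<integral>\<^sup>+s. ennreal (exp (- (l * s))) * f s \<partial>lborel)"
    by (rule nn_integral_cmult) measurable
  finally show ?thesis .
qed

section \<open>Selfdecomposable laws\<close>

definition scaled :: "real \<Rightarrow> real measure \<Rightarrow> real measure" where
  "scaled c M = distr M borel ((*) c)"

lemma nonneg_law_scaled:
  assumes M: "nonneg_law M" and c: "0 \<le> c"
  shows "nonneg_law (scaled c M)"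
proof (rule nonneg_lawI)
  interpret prob_space M using nonneg_lawD(1)[OF M] .
  have [measurable_cong]: "sets M = sets borel" using nonneg_lawD(3)[OF M] .
  show "prob_space (scaled c M)" unfolding scaled_def by (rule prob_space_distr) measurable
  show "AE x in scaled c M. 0 \<le> x"
    unfolding scaled_def using nonneg_lawD(4)[OF M] c
    by (subst AE_distr_iff) (auto elim: eventually_mono)
qed (simp add: scaled_def)

lemma laplace_scaled:
  assumes "sets M = sets borel"
  shows "laplace (scaled c M) l = laplace M (l * c)"
proof -
  have [measurable_cong]: "sets M = sets borel" by fact
  show ?thesis unfolding laplace_def scaled_def by (subst integral_distr) (auto simp: mult.assoc)
qed

lemma laplace_determines_law:
  assumes M: "nonneg_law M" and N: "nonneg_law N"
    and eq: "\<And>l. 0 < l \<Longrightarrow> laplace M l = laplace N l"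
  shows "M = N"
  by (rule lap_determines_measure)
    (use nonneg_lawD[OF M] nonneg_lawD[OF N] lap_eq_laplace[OF M] lap_eq_laplace[OF N] eq in auto)

text \<open>Independence turns the law of the sum into a convolution. Conversely, the two
  coordinates on the product of \<mu> and P are independent with the right laws, and they live on
  the sample space \<open>real \<times> real\<close> that the definition prescribes.\<close>

lemma selfdecomposable_iff_convolution:
  "selfdecomposable \<mu> \<longleftrightarrow> real_distribution \<mu> \<and>
     (\<forall>c\<in>{0<..<1}. \<exists>P. real_distribution P \<and> (scaled c \<mu> \<star> P) = \<mu>)"
proof (intro iffI)
  assume sd: "selfdecomposable \<mu>"
  show "real_distribution \<mu> \<and> (\<forall>c\<in>{0<..<1}. \<exists>P. real_distribution P \<and> (scaled c \<mu> \<star> P) = \<mu>)"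
  proof (intro conjI ballI)
    show "real_distribution \<mu>" using sd by (simp add: selfdecomposable_def)
    fix c :: real assume c: "c \<in> {0<..<1}"
    obtain M :: "(real \<times> real) measure" and X Y where M: "prob_space M"
      and ind: "prob_space.indep_var M borel X borel Y" and X: "distr M borel X = \<mu>"
      and XY: "distr M borel (\<lambda>\<omega>. c * X \<omega> + Y \<omega>) = \<mu>"
      using sd c unfolding selfdecomposable_def by blast
    interpret prob_space M by fact
    have [measurable]: "random_variable borel X" "random_variable borel Y"
      using indep_var_rv1[OF ind] indep_var_rv2[OF ind] by auto
    have "indep_var borel ((*) c \<circ> X) borel (id \<circ> Y)"
      by (rule indep_var_compose[OF ind]) auto
    then have ind': "indep_var borel (\<lambda>\<omega>. c * X \<omega>) borel Y" by (simp add: comp_def)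
    have "distr M borel (\<lambda>\<omega>. c * X \<omega> + Y \<omega>) = (distr M borel (\<lambda>\<omega>. c * X \<omega>) \<star> distr M borel Y)"
      by (rule sum_indep_random_variable[OF ind']) auto
    also have "distr M borel (\<lambda>\<omega>. c * X \<omega>) = scaled c \<mu>"
      unfolding scaled_def X[symmetric] by (subst distr_distr) (auto simp: comp_def)
    finally have "(scaled c \<mu> \<star> distr M borel Y) = \<mu>" using XY by simp
    moreover have "real_distribution (distr M borel Y)" by simp
    ultimately show "\<exists>P. real_distribution P \<and> (scaled c \<mu> \<star> P) = \<mu>" by blast
  qed
next
  assume asm: "real_distribution \<mu> \<and> (\<forall>c\<in>{0<..<1}. \<exists>P. real_distribution P \<and> (scaled c \<mu> \<star> P) = \<mu>)"
  then interpret X: real_distribution \<mu> by simp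
  show "selfdecomposable \<mu>"
    unfolding selfdecomposable_def
  proof (intro conjI ballI)
    show "real_distribution \<mu>" using asm by simp
    fix c :: real assume "c \<in> {0<..<1}"
    then obtain P where P: "real_distribution P" and eq: "(scaled c \<mu> \<star> P) = \<mu>" using asm by blast
    interpret Y: real_distribution P by fact
    interpret pair_prob_space \<mu> P ..
    have [measurable_cong]: "sets \<mu> = sets borel" "sets P = sets borel" by simp_all
    have m[measurable]: "fst \<in> borel_measurable (\<mu> \<Otimes>\<^sub>M P)" "snd \<in> borel_measurable (\<mu> \<Otimes>\<^sub>M P)"
      by measurable
    have d1: "distr (\<mu> \<Otimes>\<^sub>M P) borel fst = \<mu>"
      using Y.distr_pair_fst[of \<mu>] by (simp cong: distr_cong)
    have d2: "distr (\<mu> \<Otimes>\<^sub>M P) borel snd = P"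
    proof -
      have "distr (\<mu> \<Otimes>\<^sub>M P) borel snd = distr (distr (P \<Otimes>\<^sub>M \<mu>) (\<mu> \<Otimes>\<^sub>M P) (\<lambda>(x, y). (y, x))) borel snd"
        by (subst distr_pair_swap) simp
      also have "\<dots> = distr (P \<Otimes>\<^sub>M \<mu>) P fst"
        by (subst distr_distr) (auto simp: comp_def split_beta' intro!: distr_cong)
      also have "\<dots> = P" by (rule X.distr_pair_fst)
      finally show ?thesis .
    qed
    have ind: "prob_space.indep_var (\<mu> \<Otimes>\<^sub>M P) borel fst borel snd"
      unfolding P.indep_var_distribution_eq d1 d2
      using m by (auto intro!: distr_id[symmetric] simp: distr_id2 cong: distr_cong)
    have "indep_var borel ((*) c \<circ> fst) borel (id \<circ> snd)"
      by (rule indep_var_compose[OF ind]) auto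
    then have ind': "indep_var borel (\<lambda>\<omega>. c * fst \<omega>) borel snd" by (simp add: comp_def)
    have "distr (\<mu> \<Otimes>\<^sub>M P) borel (\<lambda>\<omega>. c * fst \<omega> + snd \<omega>)
        = (distr (\<mu> \<Otimes>\<^sub>M P) borel (\<lambda>\<omega>. c * fst \<omega>) \<star> distr (\<mu> \<Otimes>\<^sub>M P) borel snd)"
      by (rule sum_indep_random_variable[OF ind']) auto
    also have "distr (\<mu> \<Otimes>\<^sub>M P) borel (\<lambda>\<omega>. c * fst \<omega>) = scaled c (distr (\<mu> \<Otimes>\<^sub>M P) borel fst)"
      unfolding scaled_def by (subst distr_distr) (auto simp: comp_def)
    finally have "distr (\<mu> \<Otimes>\<^sub>M P) borel (\<lambda>\<omega>. c * fst \<omega> + snd \<omega>) = \<mu>"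
      unfolding d1 d2 eq .
    then show "\<exists>(M :: (real \<times> real) measure) X' Y. prob_space M \<and>
        prob_space.indep_var M borel X' borel Y \<and> distr M borel X' = \<mu> \<and>
        distr M borel (\<lambda>\<omega>. c * X' \<omega> + Y \<omega>) = \<mu>"
      using ind d1 P.prob_space_axioms by (intro exI[of _ "\<mu> \<Otimes>\<^sub>M P"] exI[of _ fst] exI[of _ snd]) simp
  qed
qed

definition bernstein_real :: "real measure \<Rightarrow> real \<Rightarrow> real" where
  "bernstein_real \<nu> l = enn2real (bernstein \<nu> l)"

lemma ennreal_bernstein_real:
  "subordinator_levy_measure \<nu> \<Longrightarrow> 0 < l \<Longrightarrow> ennreal (bernstein_real \<nu> l) = bernstein \<nu> l"
  unfolding bernstein_real_def using bernstein_finite[of \<nu> l] by simp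

lemma bernstein_real_nonneg[simp]: "0 \<le> bernstein_real \<nu> l"
  by (simp add: bernstein_real_def)

lemma borel_measurable_bernstein:
  assumes "subordinator_levy_measure \<nu>"
  shows "bernstein \<nu> \<in> borel_measurable borel"
proof -
  interpret sigma_finite_measure \<nu> by (rule levy_sigma_finite[OF assms])
  have [measurable_cong]: "sets \<nu> = sets borel" by (rule levy_sets[OF assms])
  have "(\<lambda>l. \<integral>\<^sup>+x. ennreal (1 - exp (- (l * x))) \<partial>\<nu>) \<in> borel_measurable borel" by measurable
  then show ?thesis unfolding bernstein_def[abs_def] .
qed

lemma borel_measurable_bernstein_real:
  assumes "subordinator_levy_measure \<nu>"
  shows "bernstein_real \<nu> \<in> borel_measurable borel"
  using borel_measurable_bernstein[OF assms] unfolding bernstein_real_def[abs_def] by measurable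

text \<open>
  Both sides of the theorem amount to this relation, \<open>- \<phi>'(l) / \<phi>(l) = b + K(l) / l\<close>, with \<open>b = a\<close>.
\<close>

definition log_derivative :: "real measure \<Rightarrow> real \<Rightarrow> real measure \<Rightarrow> bool" where
  "log_derivative M b \<nu> \<longleftrightarrow>
     (\<forall>l>0. laplace_moment M l = (b + bernstein_real \<nu> l / l) * laplace M l)"

text \<open>The fundamental theorem of calculus on [c, 1] for v \<mapsto> - ln \<phi>(l v), whose
  derivative is l b + K(l v) / v. In \<open>ennreal\<close>, finiteness of the integral is a
  consequence and not a premise.\<close>

lemma log_derivative_integral:
  assumes M: "nonneg_law M" and levy: "subordinator_levy_measure \<nu>" and b: "0 \<le> b"
    and ld: "log_derivative M b \<nu>" and c: "0 < c" "c \<le> 1" and l: "0 < l"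
  shows "ennreal (l * b * (1 - c)) + (\<integral>\<^sup>+v. ennreal (1 / v) * indicator {c..1} v * bernstein \<nu> (l * v) \<partial>lborel)
    = ennreal (ln (laplace M (l * c)) - ln (laplace M l))"
proof -
  have [measurable]: "bernstein_real \<nu> \<in> borel_measurable borel" "bernstein \<nu> \<in> borel_measurable borel"
    using borel_measurable_bernstein_real[OF levy] borel_measurable_bernstein[OF levy] .
  have D: "((\<lambda>v. - ln (laplace M (l * v))) has_real_derivative l * b + bernstein_real \<nu> (l * v) / v) (at v)"
    if v: "v \<in> {c..1}" for v
  proof -
    have v0: "0 < v" using v c by simp
    then have lv: "0 < l * v" using l by simp
    have "((\<lambda>v. laplace M (l * v)) has_real_derivative - laplace_moment M (l * v) * l) (at v)"
      using DERIV_chain'[where f="\<lambda>v. l * v" and g="laplace M", OF _ DERIV_laplace[OF M lv]]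
      by (auto intro!: derivative_eq_intros)
    then have "((\<lambda>v. - ln (laplace M (l * v))) has_real_derivative
        - (1 / laplace M (l * v) * (- laplace_moment M (l * v) * l))) (at v)"
      using laplace_pos[OF M, of "l * v"] lv by (intro DERIV_minus DERIV_chain'[OF _ DERIV_ln_divide]) auto
    moreover have "laplace_moment M (l * v) = (b + bernstein_real \<nu> (l * v) / (l * v)) * laplace M (l * v)"
      using ld lv by (simp add: log_derivative_def)
    then have "- (1 / laplace M (l * v) * (- laplace_moment M (l * v) * l)) = l * b + bernstein_real \<nu> (l * v) / v"
      using laplace_pos[OF M, of "l * v"] lv l v0 by (simp add: field_simps)
    ultimately show ?thesis by simp
  qed
  have "ennreal (- ln (laplace M (l * 1)) - - ln (laplace M (l * c)))
      = (\<integral>\<^sup>+v. ennreal (l * b + bernstein_real \<nu> (l * v) / v) * indicator {c..1} v \<partial>lborel)"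
    using D c l b by (intro nn_integral_FTC_Icc[symmetric]) auto
  also have "\<dots> = (\<integral>\<^sup>+v. ennreal (l * b) * indicator {c..1} v
      + ennreal (1 / v) * indicator {c..1} v * bernstein \<nu> (l * v) \<partial>lborel)"
  proof (rule nn_integral_cong)
    fix v
    show "ennreal (l * b + bernstein_real \<nu> (l * v) / v) * indicator {c..1} v =
      ennreal (l * b) * indicator {c..1} v + ennreal (1 / v) * indicator {c..1} v * bernstein \<nu> (l * v)"
    proof (cases "v \<in> {c..1}")
      case True
      then have v: "0 < v" using c by simp
      have "ennreal (l * b + bernstein_real \<nu> (l * v) / v)
          = ennreal (l * b) + ennreal (1 / v) * ennreal (bernstein_real \<nu> (l * v))"
        using l b v by (simp add: ennreal_plus[symmetric] ennreal_mult[symmetric] del: ennreal_plus)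
      then show ?thesis using ennreal_bernstein_real[OF levy, of "l * v"] l v True by simp
    qed simp
  qed
  also have "\<dots> = (\<integral>\<^sup>+v. ennreal (l * b) * indicator {c..1} v \<partial>lborel)
      + (\<integral>\<^sup>+v. ennreal (1 / v) * indicator {c..1} v * bernstein \<nu> (l * v) \<partial>lborel)"
    by (rule nn_integral_add) auto
  also have "(\<integral>\<^sup>+v. ennreal (l * b) * indicator {c..1} v \<partial>lborel) = ennreal (l * b * (1 - c))"
    using c l b by (subst nn_integral_cmult_indicator) (auto simp: ennreal_mult[symmetric])
  finally show ?thesis by simp
qed

lemma laplace_ratio_law:
  assumes M: "nonneg_law M" and levy: "subordinator_levy_measure \<nu>" and b: "0 \<le> b"
    and ld: "log_derivative M b \<nu>" and c: "0 < c" "c < 1"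
  obtains N where "nonneg_law N" "\<And>l. 0 < l \<Longrightarrow> laplace M (l * c) * laplace N l = laplace M l"
proof -
  define V where "V = density lborel (\<lambda>v. ennreal (1 / v) * indicator {c..1} v)"
  define \<eta> where "\<eta> = distr (\<nu> \<Otimes>\<^sub>M V) borel (\<lambda>(x, v). x * v)"
  interpret nu: sigma_finite_measure \<nu> by (rule levy_sigma_finite[OF levy])
  have [measurable_cong]: "sets \<nu> = sets borel" by (rule levy_sets[OF levy])
  have [measurable_cong]: "sets V = sets borel" by (simp add: V_def)
  interpret V: sigma_finite_measure V
    unfolding V_def by (subst sigma_finite_measure.sigma_finite_iff_density_finite[OF lborel.sigma_finite_measure_axioms]) (auto split: split_indicator)
  interpret pair_sigma_finite \<nu> V ..
  have [measurable]: "bernstein \<nu> \<in> borel_measurable borel" by (rule borel_measurable_bernstein[OF levy])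
  have sE: "sets \<eta> = sets borel" by (simp add: \<eta>_def)
  have nnV: "AE v in V. c \<le> v"
    unfolding V_def by (subst AE_density) (auto split: split_indicator)
  have "AE p in \<nu> \<Otimes>\<^sub>M V. 0 \<le> fst p * snd p"
  proof (rule AE_pair_measure)
    show "AE x in \<nu>. AE v in V. 0 \<le> fst (x, v) * snd (x, v)"
      using levy_AE_pos[OF levy]
    proof eventually_elim
      case (elim x)
      show ?case using nnV by eventually_elim (use elim c in auto)
    qed
  qed measurable
  then have nn: "AE x in \<eta>. 0 \<le> x"
    unfolding \<eta>_def by (subst AE_distr_iff) (auto simp: split_beta')
  define A where "A l = ln (laplace M (l * c)) - ln (laplace M l) - l * b * (1 - c)" for l
  have bE: "(\<integral>\<^sup>+x. ennreal (1 - exp (- (l * x))) \<partial>\<eta>)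
      = (\<integral>\<^sup>+v. ennreal (1 / v) * indicator {c..1} v * bernstein \<nu> (l * v) \<partial>lborel)" for l
  proof -
    have "(\<integral>\<^sup>+x. ennreal (1 - exp (- (l * x))) \<partial>\<eta>)
        = (\<integral>\<^sup>+p. ennreal (1 - exp (- (l * (fst p * snd p)))) \<partial>(\<nu> \<Otimes>\<^sub>M V))"
      unfolding \<eta>_def by (subst nn_integral_distr) (auto simp: split_beta')
    also have "\<dots> = (\<integral>\<^sup>+v. \<integral>\<^sup>+x. ennreal (1 - exp (- (l * (x * v)))) \<partial>\<nu> \<partial>V)"
      by (subst nn_integral_snd[symmetric]) auto
    also have "\<dots> = (\<integral>\<^sup>+v. bernstein \<nu> (l * v) \<partial>V)"
      unfolding bernstein_def by (intro nn_integral_cong) (simp add: ac_simps)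
    also have "\<dots> = (\<integral>\<^sup>+v. ennreal (1 / v) * indicator {c..1} v * bernstein \<nu> (l * v) \<partial>lborel)"
      unfolding V_def by (subst nn_integral_density) auto
    finally show ?thesis .
  qed
  have A: "(\<integral>\<^sup>+x. ennreal (1 - exp (- (l * x))) \<partial>\<eta>) = ennreal (A l)" "0 \<le> A l" if l: "0 < l" for l
  proof -
    define I where "I = (\<integral>\<^sup>+x. ennreal (1 - exp (- (l * x))) \<partial>\<eta>)"
    have eq: "ennreal (l * b * (1 - c)) + I = ennreal (ln (laplace M (l * c)) - ln (laplace M l))"
      unfolding I_def bE using log_derivative_integral[OF M levy b ld c(1) _ l] c by simp
    \<comment> \<open>I is a summand of a finite value. This yields the integrability that the
      construction of an infinitely divisible law asks for.\<close>
    have "I \<noteq> \<infinity>" using eq by (metis ennreal_neq_top infinity_ennreal_def ennreal_add_eq_top)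
    then obtain i where i: "I = ennreal i" "0 \<le> i" by (cases I) auto
    have "ln (laplace M l) \<le> ln (laplace M (l * c))"
      using laplace_antimono[OF M, of "l * c" l] laplace_pos[OF M] l c by simp
    moreover have "ennreal (l * b * (1 - c) + i) = ennreal (ln (laplace M (l * c)) - ln (laplace M l))"
      using eq i l b c by (simp add: ennreal_plus)
    ultimately have "l * b * (1 - c) + i = ln (laplace M (l * c)) - ln (laplace M l)"
      using i l b c by (subst (asm) ennreal_inj) auto
    then have "i = A l" by (simp add: A_def)
    then show "(\<integral>\<^sup>+x. ennreal (1 - exp (- (l * x))) \<partial>\<eta>) = ennreal (A l)" "0 \<le> A l"
      using i by (simp_all add: I_def)
  qed
  have [measurable_cong]: "sets \<eta> = sets borel" by (rule sE)
  have AEp: "AE x in \<eta>. 0 \<le> 1 - exp (- (l * x))" if "0 < l" for l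
    using nn by eventually_elim (use that in auto)
  have int: "integrable \<eta> (\<lambda>x. 1 - exp (- (l * x)))" if l: "0 < l" for l
    using A[OF l] AEp[OF l] by (intro integrableI_nonneg) auto
  obtain N where N: "nonneg_law N" "\<And>l. 0 < l \<Longrightarrow> laplace N l = exp (- (\<integral>x. 1 - exp (- (l * x)) \<partial>\<eta>))"
    using infinitely_divisible_law[OF sE nn int] by metis
  have b': "0 \<le> (1 - c) * b" using b c by simp
  show thesis
  proof (rule that)
    \<comment> \<open>The point mass supplies the drift factor exp (- l (1 - c) b).\<close>
    show "nonneg_law (N \<star> return borel ((1 - c) * b))"
      by (intro nonneg_law_convolution N nonneg_law_return b')
    fix l :: real assume l: "0 < l"
    have "(\<integral>x. 1 - exp (- (l * x)) \<partial>\<eta>) = A l"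
      using A[OF l] AEp[OF l] by (subst integral_eq_nn_integral) auto
    then have "laplace (N \<star> return borel ((1 - c) * b)) l = exp (- A l) * exp (- (l * ((1 - c) * b)))"
      using N(2)[OF l] l by (simp add: laplace_convolution[OF N(1) nonneg_law_return[OF b']] laplace_return)
    also have "\<dots> = exp (ln (laplace M l) - ln (laplace M (l * c)))"
      unfolding mult_exp_exp A_def by (rule arg_cong[of _ _ exp]) algebra
    also have "\<dots> = laplace M l / laplace M (l * c)"
      using laplace_pos[OF M] l c by (simp add: exp_diff)
    finally show "laplace M (l * c) * laplace (N \<star> return borel ((1 - c) * b)) l = laplace M l"
      using laplace_pos[OF M, of "l * c"] l c by simp
  qed
qed

lemma log_derivative_imp_selfdecomposable:
  assumes M: "nonneg_law M" and levy: "subordinator_levy_measure \<nu>" and b: "0 \<le> b"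
    and ld: "log_derivative M b \<nu>"
  shows "selfdecomposable M"
  unfolding selfdecomposable_iff_convolution
proof (intro conjI ballI)
  show "real_distribution M" using nonneg_lawD(5)[OF M] .
  fix c :: real assume "c \<in> {0<..<1}"
  then have c: "0 < c" "c < 1" by auto
  obtain N where N: "nonneg_law N" and rat: "\<And>l. 0 < l \<Longrightarrow> laplace M (l * c) * laplace N l = laplace M l"
    using laplace_ratio_law[OF M levy b ld c] by metis
  have S: "nonneg_law (scaled c M)" using c by (intro nonneg_law_scaled M) simp
  have "(scaled c M \<star> N) = M"
    by (rule laplace_determines_law[OF nonneg_law_convolution[OF S N] M])
      (simp add: laplace_convolution[OF S N] laplace_scaled[OF nonneg_lawD(3)[OF M]] rat)
  then show "\<exists>P. real_distribution P \<and> (scaled c M \<star> P) = M" using nonneg_lawD(5)[OF N] by blast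
qed

section \<open>Limits of selfdecompositions\<close>

text \<open>Suppose P charged the half-line below - e. Adding c x with x < a + e / c, which has
  positive probability, would put mass of the sum below c a \<le> a, where M has none.\<close>

lemma nonneg_law_deconvolution:
  assumes M: "nonneg_law M" and a: "0 \<le> a" "emeasure M {..<a} = 0"
    and a_inf: "\<And>d. 0 < d \<Longrightarrow> 0 < emeasure M {..<a + d}"
    and c: "0 < c" "c < 1" and P: "real_distribution P" and eq: "(scaled c M \<star> P) = M"
  shows "nonneg_law P"
  unfolding nonneg_law_def
proof
  show "real_distribution P" by fact
  interpret P: real_distribution P by fact
  have sM[measurable_cong]: "sets M = sets borel" using nonneg_lawD(3)[OF M] .
  have S: "nonneg_law (scaled c M)" using c by (intro nonneg_law_scaled M) simp
  have meas[measurable]: "(\<lambda>x. emeasure P {y. y + x < a}) \<in> borel_measurable borel"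
  proof -
    have "(\<lambda>x. emeasure P (Pair x -` {p \<in> space (borel \<Otimes>\<^sub>M P). snd p + fst p < a})) \<in> borel_measurable borel"
      by (rule P.measurable_emeasure_Pair) measurable
    then show ?thesis by (simp add: vimage_def space_pair_measure)
  qed
  have "emeasure M {..<a} = emeasure (scaled c M \<star> P) {..<a}" by (simp add: eq)
  also have "\<dots> = (\<integral>\<^sup>+x. emeasure P {y. y + x \<in> {..<a}} \<partial>scaled c M)"
    by (intro convolution_emeasure P.finite_measure_axioms nonneg_lawD(2)[OF S])
      (auto simp: scaled_def)
  also have "\<dots> = (\<integral>\<^sup>+x. emeasure P {y. y + c * x < a} \<partial>M)"
    unfolding scaled_def by (subst nn_integral_distr) auto
  finally have "(\<integral>\<^sup>+x. emeasure P {y. y + c * x < a} \<partial>M) = 0" using a by simp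
  then have AE0: "AE x in M. emeasure P {y. y + c * x < a} = 0"
    by (subst (asm) nn_integral_0_iff_AE) auto
  have null: "emeasure P {..<- e} = 0" if e: "0 < e" for e
  proof (rule ccontr)
    assume ne: "emeasure P {..<- e} \<noteq> 0"
    have "AE x in M. \<not> x < a + e / c"
      using AE0
    proof eventually_elim
      case (elim x)
      show ?case
      proof
        assume "x < a + e / c"
        then have "c * x < c * a + e" using c by (simp add: field_simps)
        moreover have "c * a \<le> a" using c a by (simp add: mult_left_le_one_le)
        ultimately have "{..<- e} \<subseteq> {y. y + c * x < a}" by auto
        then have "emeasure P {..<- e} \<le> emeasure P {y. y + c * x < a}" by (intro emeasure_mono) auto
        then show False using elim ne by simp
      qed
    qed
    then have "emeasure M {..<a + e / c} = 0"
      by (subst (asm) AE_iff_measurable[of "{..<a + e / c}"]) (auto simp: sM sets_eq_imp_space_eq[OF sM])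
    then show False using a_inf[of "e / c"] e c by simp
  qed
  have "AE y in P. \<forall>n. - (1 / real (Suc n)) \<le> y"
    unfolding AE_all_countable
  proof
    fix n
    show "AE y in P. - (1 / real (Suc n)) \<le> y"
      using null[of "1 / real (Suc n)"]
      by (subst AE_iff_measurable[of "{..<- (1 / real (Suc n))}"]) auto
  qed
  then show "AE y in P. 0 \<le> y"
  proof eventually_elim
    case (elim y)
    show ?case
    proof (rule ccontr)
      assume "\<not> 0 \<le> y"
      then obtain n where "inverse (real (Suc n)) < - y" using reals_Archimedean[of "- y"] by auto
      then show False using elim[rule_format, of n] by (simp add: inverse_eq_divide)
    qed
  qed
qed

text \<open>The weight 1 - exp (- y) has total mass d under P, and its product with exp (- l y) is a
  difference of two exponentials, so the transform of T can be read off from that of P.\<close>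

lemma
  assumes P: "nonneg_law P" and d: "d = 1 - laplace P 1" "0 < d"
  defines "T \<equiv> density P (\<lambda>y. ennreal ((1 - exp (- y)) / d))"
  shows nonneg_law_tilt: "nonneg_law T"
    and laplace_tilt: "0 \<le> l \<Longrightarrow> laplace T l = (laplace P l - laplace P (l + 1)) / d"
proof -
  interpret prob_space P using nonneg_lawD(1)[OF P] .
  have sP[measurable_cong]: "sets P = sets borel" using nonneg_lawD(3)[OF P] .
  have nn: "AE y in P. 0 \<le> (1 - exp (- y)) / d"
    using nonneg_lawD(4)[OF P] by eventually_elim (use d in auto)
  have i1: "integrable P (\<lambda>y. exp (- y))" using laplace_integrable[OF P, of 1] by simp
  show "nonneg_law T"
  proof (rule nonneg_lawI)
    show "prob_space T"
    proof
      have "emeasure T (space T) = (\<integral>\<^sup>+y. ennreal ((1 - exp (- y)) / d) \<partial>P)"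
        unfolding T_def by (auto simp: emeasure_density sets_eq_imp_space_eq[OF sP])
      also have "\<dots> = ennreal (\<integral>y. (1 - exp (- y)) / d \<partial>P)"
        by (rule nn_integral_eq_integral[OF _ nn]) (use i1 in simp)
      also have "(\<integral>y. (1 - exp (- y)) / d \<partial>P) = 1"
        using i1 d by (simp add: laplace_def prob_space)
      finally show "emeasure T (space T) = 1" by simp
    qed
    show "AE x in T. 0 \<le> x"
      unfolding T_def using nonneg_lawD(4)[OF P] by (subst AE_density) (auto elim: eventually_mono)
  qed (simp add: T_def sP)
  show "laplace T l = (laplace P l - laplace P (l + 1)) / d" if l: "0 \<le> l"
  proof -
    have "laplace T l = (\<integral>y. ((1 - exp (- y)) / d) *\<^sub>R exp (- (l * y)) \<partial>P)"
      unfolding laplace_def T_def by (rule integral_density[OF _ _ nn]) auto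
    also have "\<dots> = (\<integral>y. (exp (- (l * y)) - exp (- ((l + 1) * y))) / d \<partial>P)"
    proof (intro Bochner_Integration.integral_cong refl)
      fix y
      have "exp (- y) * exp (- (l * y)) = exp (- ((l + 1) * y))"
        by (simp add: mult_exp_exp algebra_simps)
      then show "((1 - exp (- y)) / d) *\<^sub>R exp (- (l * y)) = (exp (- (l * y)) - exp (- ((l + 1) * y))) / d"
        by (simp add: left_diff_distrib)
    qed
    also have "\<dots> = (laplace P l - laplace P (l + 1)) / d"
      using laplace_integrable[OF P, of l] laplace_integrable[OF P, of "l + 1"] l
      by (simp add: laplace_def)
    finally show ?thesis .
  qed
qed

text \<open>Even when the mean is infinite, u exp (- u) \<le> 1 with u = l x gives a dominating
  constant.\<close>

lemma laplace_moment_vanishes: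
  assumes M: "nonneg_law M"
  shows "((\<lambda>l. l * laplace_moment M l) \<longlongrightarrow> 0) (at_right 0)"
  unfolding tendsto_at_iff_sequentially
proof (intro allI impI)
  fix X :: "nat \<Rightarrow> real" assume X: "\<forall>i. X i \<in> {0<..} - {0}" "X \<longlonglongrightarrow> 0"
  interpret prob_space M using nonneg_lawD(1)[OF M] .
  have [measurable_cong]: "sets M = sets borel" using nonneg_lawD(3)[OF M] .
  have "(\<lambda>n. \<integral>x. X n * (x * exp (- (X n * x))) \<partial>M) \<longlonglongrightarrow> (\<integral>x. 0 \<partial>M)"
  proof (rule integral_dominated_convergence[where w="\<lambda>x. 1"])
    show "AE x in M. (\<lambda>n. X n * (x * exp (- (X n * x)))) \<longlonglongrightarrow> 0"
    proof (rule AE_I2)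
      fix x
      have "(\<lambda>n. X n * (x * exp (- (X n * x)))) \<longlonglongrightarrow> 0 * (x * exp (- (0 * x)))" by (intro tendsto_intros X)
      then show "(\<lambda>n. X n * (x * exp (- (X n * x)))) \<longlonglongrightarrow> 0" by simp
    qed
    show "AE x in M. norm (X n * (x * exp (- (X n * x)))) \<le> 1" for n
      using nonneg_lawD(4)[OF M]
    proof eventually_elim
      case (elim x)
      have u: "0 \<le> X n * x" using elim X(1) by (auto simp: less_imp_le)
      have "X n * x \<le> exp (X n * x)" using exp_ge_add_one_self[of "X n * x"] by linarith
      then have "X n * x * exp (- (X n * x)) \<le> 1" by (simp add: exp_minus field_simps)
      then show ?case using u by (simp add: mult.assoc[symmetric])
    qed
  qed auto
  then show "((\<lambda>l. l * laplace_moment M l) \<circ> X) \<longlonglongrightarrow> 0" by (simp add: laplace_moment_def comp_def)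
qed

lemma limit_of_selfdecomposition:
  assumes M: "nonneg_law M" and pos: "\<And>l. 0 < l \<Longrightarrow> 0 < laplace_moment M l"
    and sd: "\<And>c. 0 < c \<Longrightarrow> c < 1 \<Longrightarrow>
      \<exists>P. nonneg_law P \<and> (\<forall>l>0. laplace M (l * c) * laplace P l = laplace M l)"
  defines "k \<equiv> \<lambda>l. l * laplace_moment M l / laplace M l"
  obtains Q where "nonneg_law Q" "\<And>l. 0 < l \<Longrightarrow> k (l + 1) = k l + k 1 * laplace Q l"
proof -
  \<comment> \<open>The shift by 2 puts every \<open>c n\<close> strictly between 0 and 1, also for
    n = 0.\<close>
  define c where "c n = 1 - 1 / real (n + 2)" for n
  have c: "0 < c n" "c n < 1" for n unfolding c_def by auto
  have "\<forall>n. \<exists>P. nonneg_law P \<and> (\<forall>l>0. laplace M (l * c n) * laplace P l = laplace M l)"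
    using sd c by blast
  from choice[OF this] obtain P where P: "\<And>n. nonneg_law (P n)"
    and rat: "\<And>n l. 0 < l \<Longrightarrow> laplace M (l * c n) * laplace (P n) l = laplace M l" by blast
  have Pl: "laplace (P n) l = laplace M l / laplace M (l * c n)" if "0 < l" for n l
    using rat[OF that, of n] laplace_pos[OF M, of "l * c n"] that c[of n] by (simp add: field_simps)
  have k1: "0 < k 1" unfolding k_def using pos[of 1] laplace_pos[OF M, of 1] by simp
  have c_lim: "c \<longlonglongrightarrow> 1"
    unfolding c_def by real_asymp
  have quot: "(\<lambda>n. (1 - laplace (P n) l) / (1 - c n)) \<longlonglongrightarrow> k l" if l: "0 < l" for l
  proof -
    have "((\<lambda>v. laplace M (l * v)) has_real_derivative - laplace_moment M l * l) (at 1)"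
      using DERIV_chain'[where f="\<lambda>v. l * v" and g="laplace M" and x=1 and s=UNIV and D=l, OF _ DERIV_laplace[OF M]] l
      by (auto intro!: derivative_eq_intros)
    then have lim1: "(\<lambda>n. (laplace M (l * c n) - laplace M l) / (c n - 1)) \<longlonglongrightarrow> - laplace_moment M l * l"
      using c_lim c unfolding has_field_derivative_iff tendsto_at_iff_sequentially
      by (auto simp: comp_def less_imp_neq)
    have lim2: "(\<lambda>n. laplace M (l * c n)) \<longlonglongrightarrow> laplace M (l * 1)"
      using DERIV_isCont[OF DERIV_laplace[OF M l]] c_lim
      by (intro isCont_tendsto_compose[of _ "laplace M"] tendsto_intros) auto
    have "(\<lambda>n. - ((laplace M (l * c n) - laplace M l) / (c n - 1)) / laplace M (l * c n))
        \<longlonglongrightarrow> - (- laplace_moment M l * l) / laplace M (l * 1)"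
      using lim1 lim2 laplace_pos[OF M, of l] l by (intro tendsto_intros) auto
    moreover have "- ((laplace M (l * c n) - laplace M l) / (c n - 1)) / laplace M (l * c n)
        = (1 - laplace (P n) l) / (1 - c n)" for n
      using Pl[OF l, of n] laplace_pos[OF M, of "l * c n"] c[of n] l
      by (simp add: divide_simps) (simp add: algebra_simps)
    ultimately show ?thesis by (simp add: k_def mult.commute)
  qed
  define d where "d n = 1 - laplace (P n) 1" for n
  \<comment> \<open>The transform of M is strictly decreasing, so the remainder is not the point
    mass at 0 and the tilted measure can be normalised.\<close>
  have d: "0 < d n" for n
  proof -
    have "laplace M (1 * c n) > laplace M 1"
    proof (rule DERIV_neg_imp_decreasing[where f="laplace M"])
      show "1 * c n < 1" using c by simp
      fix x assume "1 * c n \<le> x"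
      then have "0 < x" using c[of n] by simp
      then show "\<exists>y. DERIV (laplace M) x :> y \<and> y < 0" using DERIV_laplace[OF M] pos by fastforce
    qed
    then show ?thesis unfolding d_def using Pl[of 1 n] laplace_pos[OF M, of "1 * c n"] c[of n] by simp
  qed
  define T where "T n = density (P n) (\<lambda>y. ennreal ((1 - exp (- y)) / d n))" for n
  have T: "nonneg_law (T n)" for n
    unfolding T_def using nonneg_law_tilt[OF P d_def[of n] d] .
  define L where "L l = (k (l + 1) - k l) / k 1" for l
  have "(\<lambda>n. laplace (T n) l) \<longlonglongrightarrow> L l" if l: "0 < l" for l
  proof -
    \<comment> \<open>Numerator and denominator are divided by \<open>1 - c n\<close>, so that
      \<open>quot\<close> applies at l + 1, l and 1.\<close>
    have "laplace (T n) l = ((1 - laplace (P n) (l + 1)) / (1 - c n) - (1 - laplace (P n) l) / (1 - c n)) / ((1 - laplace (P n) 1) / (1 - c n))" for n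
    proof -
      have "laplace (T n) l = (laplace (P n) l - laplace (P n) (l + 1)) / d n"
        unfolding T_def using laplace_tilt[OF P d_def[of n] d, of l] l by simp
      then show ?thesis using c[of n] by (simp add: d_def diff_divide_distrib[symmetric])
    qed
    moreover have "(\<lambda>n. ((1 - laplace (P n) (l + 1)) / (1 - c n) - (1 - laplace (P n) l) / (1 - c n)) / ((1 - laplace (P n) 1) / (1 - c n))) \<longlonglongrightarrow> L l"
      unfolding L_def using k1 l by (intro tendsto_divide tendsto_diff quot) auto
    ultimately show ?thesis by simp
  qed
  \<comment> \<open>No mass escapes to infinity: k is continuous at 1 and tends to 0 at 0.\<close>
  moreover have "(L \<longlongrightarrow> 1) (at_right 0)"
  proof -
    have "isCont k 1" unfolding k_def
      using isCont_laplace_moment[OF M, of 1] DERIV_isCont[OF DERIV_laplace[OF M, of 1]] laplace_pos[OF M, of 1]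
      by (intro continuous_intros) auto
    then have "((\<lambda>l. k (l + 1)) \<longlongrightarrow> k 1) (at_right 0)"
      by (rule isCont_tendsto_compose) (auto intro!: tendsto_eq_intros)
    moreover have "(k \<longlongrightarrow> 0 / 1) (at_right 0)"
      unfolding k_def by (intro tendsto_divide laplace_moment_vanishes[OF M] laplace_tendsto_1[OF M]) simp
    ultimately have "(L \<longlongrightarrow> (k 1 - 0 / 1) / k 1) (at_right 0)"
      unfolding L_def using k1 by (intro tendsto_divide tendsto_diff) auto
    then show ?thesis using k1 by simp
  qed
  ultimately obtain Q where Q: "nonneg_law Q" "\<And>l. 0 < l \<Longrightarrow> laplace Q l = L l"
    using laplace_limit[where P=T and L=L] T by metis
  show thesis
    by (rule that[OF Q(1)]) (use Q(2) k1 in \<open>simp add: L_def\<close>)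
qed

text \<open>
  Multiplying \<open>Q\<close> by \<open>(1 - exp (- n y)) / (1 - exp (- y))\<close>, a geometric sum, turns the difference
  equation for \<open>k\<close> into the Levy-Khintchine representation at the integers.
\<close>

lemma levy_khintchine_of_difference_equation:
  fixes k :: "real \<Rightarrow> real"
  assumes Q: "nonneg_law Q" and k1: "0 < k 1"
    and k: "\<And>l. 0 < l \<Longrightarrow> k (l + 1) = k l + k 1 * laplace Q l"
  obtains \<nu> and b :: real where "subordinator_levy_measure \<nu>" "0 \<le> b"
    "\<And>n::nat. 1 \<le> n \<Longrightarrow> k (real n) = b * real n + bernstein_real \<nu> (real n)"
proof -
  interpret prob_space Q using nonneg_lawD(1)[OF Q] .
  have sQ[measurable_cong]: "sets Q = sets borel" using nonneg_lawD(3)[OF Q] .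
  have spQ: "space Q = UNIV" using sets_eq_imp_space_eq[OF sQ] by simp
  \<comment> \<open>Undoes the tilt and the normalisation away from 0.\<close>
  define w where "w y = indicator {0<..} y * (k 1 / (1 - exp (- y)))" for y :: real
  have w0: "0 \<le> w y" for y using k1 by (auto simp: w_def split: split_indicator)
  have [measurable]: "w \<in> borel_measurable borel" unfolding w_def by measurable
  define \<nu> where "\<nu> = density Q (\<lambda>y. ennreal (w y))"
  \<comment> \<open>At y = 0 the tilt cannot be undone. There all n terms of the geometric sum are
    1, so the atom contributes a term linear in n, the drift.\<close>
  define b where "b = k 1 * measure Q {0}"
  \<comment> \<open>The difference equation telescopes from n = 1, where the only summand is the
    total mass \<open>laplace Q 0 = 1\<close>.\<close>
  have kn: "k (real n) = k 1 * (\<Sum>j<n. laplace Q (real j))" if "1 \<le> n" for n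
    using that
  proof (induction n rule: dec_induct)
    case base
    show ?case by (simp add: laplace_def prob_space)
  next
    case (step n)
    have "k (real (Suc n)) = k (real n) + k 1 * laplace Q (real n)"
      using k[of "real n"] step.hyps by (simp add: add.commute)
    then show ?case using step.IH by (simp add: distrib_left)
  qed
  have il: "integrable Q (\<lambda>y. exp (- (real j * y)))" for j using laplace_integrable[OF Q] by simp
  have levy: "subordinator_levy_measure \<nu>"
    unfolding subordinator_levy_measure_def
  proof (intro conjI)
    show "sets \<nu> = sets borel" by (simp add: \<nu>_def sQ)
    have "emeasure \<nu> {..0} = (\<integral>\<^sup>+y. ennreal (w y) * indicator {..0} y \<partial>Q)"
      unfolding \<nu>_def by (rule emeasure_density) (auto simp: sQ)
    also have "\<dots> = (\<integral>\<^sup>+y. 0 \<partial>Q)" by (rule nn_integral_cong) (auto simp: w_def split: split_indicator)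
    finally show "emeasure \<nu> {..0} = 0" by simp
    have "(\<integral>\<^sup>+x\<in>{0<..}. ennreal (min 1 x) \<partial>\<nu>) = (\<integral>\<^sup>+y. ennreal (w y) * (ennreal (min 1 y) * indicator {0<..} y) \<partial>Q)"
      unfolding \<nu>_def by (rule nn_integral_density) auto
    also have "\<dots> \<le> (\<integral>\<^sup>+y. ennreal (2 * k 1) \<partial>Q)"
    proof (rule nn_integral_mono)
      fix y
      have "k 1 / (1 - exp (- y)) * min 1 y \<le> 2 * k 1" if y: "0 < y"
        using mult_left_mono[OF one_minus_exp_ge_min[of y], of "k 1"] y k1 by (simp add: field_simps)
      then show "ennreal (w y) * (ennreal (min 1 y) * indicator {0<..} y) \<le> ennreal (2 * k 1)"
        using k1 by (auto simp: w_def ennreal_mult[symmetric] intro!: ennreal_leI split: split_indicator)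
    qed
    also have "\<dots> < \<infinity>" using emeasure_space_1 by simp
    finally show "(\<integral>\<^sup>+x\<in>{0<..}. ennreal (min 1 x) \<partial>\<nu>) < \<infinity>" .
  qed
  show thesis
  proof (rule that[OF levy, of b])
    show "0 \<le> b" using k1 by (simp add: b_def)
    fix n :: nat assume n: "1 \<le> n"
    define S where "S y = k 1 * (\<Sum>j<n. exp (- (real j * y)))" for y
    have S0: "0 \<le> S y" for y using k1 by (auto simp: S_def intro!: mult_nonneg_nonneg sum_nonneg)
    have [measurable]: "S \<in> borel_measurable borel" unfolding S_def by measurable
    have iS: "integrable Q S" unfolding S_def using il by (intro integrable_mult_right Bochner_Integration.integrable_sum)
    have "bernstein \<nu> n = (\<integral>\<^sup>+y. ennreal (w y) * ennreal (1 - exp (- (real n * y))) \<partial>Q)"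
      unfolding bernstein_def \<nu>_def by (rule nn_integral_density) auto
    also have "\<dots> = (\<integral>\<^sup>+y. ennreal (indicator {0<..} y * S y) \<partial>Q)"
    proof (rule nn_integral_cong)
      fix y
      have "k 1 / (1 - exp (- y)) * (1 - exp (- (real n * y))) = S y" if y: "0 < y"
      proof -
        have "exp (- (real j * y)) = exp (- y) ^ j" for j
          by (simp add: exp_of_nat_mult[symmetric])
        then show ?thesis using y by (simp add: S_def sum_gp_strict)
      qed
      then show "ennreal (w y) * ennreal (1 - exp (- (real n * y))) = ennreal (indicator {0<..} y * S y)"
        using k1 by (auto simp: w_def ennreal_mult[symmetric] split: split_indicator)
    qed
    finally have K: "bernstein_real \<nu> n = (\<integral>y. indicator {0<..} y * S y \<partial>Q)"
      unfolding bernstein_real_def using S0 by (subst integral_eq_nn_integral) auto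
    have "k n = (\<integral>y. S y \<partial>Q)"
      using kn[OF n] il unfolding S_def by (simp add: laplace_def)
    also have "\<dots> = (\<integral>y. indicator {0<..} y * S y + (k 1 * n) * indicator {0} y \<partial>Q)"
    proof (rule integral_cong_AE)
      show "AE y in Q. S y = indicator {0<..} y * S y + (k 1 * n) * indicator {0} y"
        using nonneg_lawD(4)[OF Q] by eventually_elim (auto simp: S_def split: split_indicator)
    qed auto
    also have "\<dots> = (\<integral>y. indicator {0<..} y * S y \<partial>Q) + (\<integral>y. (k 1 * n) * indicator {0} y \<partial>Q)"
    proof (rule Bochner_Integration.integral_add)
      show "integrable Q (\<lambda>y. indicator {0<..} y * S y)"
        by (rule Bochner_Integration.integrable_bound[OF iS]) (auto split: split_indicator)
      show "integrable Q (\<lambda>y. (k 1 * n) * indicator {0} y)"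
        by (intro integrable_mult_right integrable_real_indicator) (auto simp: emeasure_eq_measure sQ)
    qed
    also have "(\<integral>y. (k 1 * n) * indicator {0} y \<partial>Q) = b * n"
      by (simp add: b_def spQ)
    finally show "k (real n) = b * real n + bernstein_real \<nu> (real n)" using K by simp
  qed
qed

section \<open>Densities on a half-line\<close>

definition tail_convolution :: "real measure \<Rightarrow> (real \<Rightarrow> real) \<Rightarrow> real \<Rightarrow> ennreal" where
  "tail_convolution \<nu> f t = (\<integral>\<^sup>+s. tail \<nu> (t - s) * ennreal (f s) \<partial>lborel)"

lemma borel_measurable_tail_convolution:
  assumes "subordinator_levy_measure \<nu>" and [measurable]: "f \<in> borel_measurable borel"
  shows "tail_convolution \<nu> f \<in> borel_measurable borel"
proof -
  have [measurable]: "tail \<nu> \<in> borel_measurable borel" by (rule borel_measurable_tail[OF assms(1)])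
  show ?thesis unfolding tail_convolution_def[abs_def] by measurable
qed

text \<open>A nonzero value at t would persist on some interval to the right of t, and such an
  interval has positive Lebesgue measure.\<close>

lemma isCont_AE_zero:
  fixes h :: "real \<Rightarrow> real"
  assumes h: "isCont h t" and u: "t < u"
    and ae: "AE x in lborel. t < x \<longrightarrow> x < u \<longrightarrow> h x = 0"
  shows "h t = 0"
proof (rule ccontr)
  assume "h t \<noteq> 0"
  then have "\<forall>\<^sub>F x in at t. h x \<noteq> 0"
    using h unfolding isCont_def by (intro tendsto_imp_eventually_ne)
  then obtain e where e: "0 < e" "\<And>x. x \<noteq> t \<Longrightarrow> dist x t < e \<Longrightarrow> h x \<noteq> 0"
    by (auto simp: eventually_at)
  define r where "r = min (t + e) u"
  have "AE x in lborel. x \<notin> {t<..<r}"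
    using ae
  proof eventually_elim
    case (elim x)
    then show ?case using e(2)[of x] by (auto simp: r_def dist_real_def)
  qed
  then have "emeasure lborel {t<..<r} = 0"
    by (subst (asm) AE_iff_measurable[of "{t<..<r}"]) auto
  then show False using e(1) u by (simp add: r_def)
qed

locale half_line_density =
  fixes a :: real and f :: "real \<Rightarrow> real"
  assumes a_nonneg: "0 \<le> a"
    and f_measurable[measurable]: "f \<in> borel_measurable borel"
    and f_nonneg: "\<And>t. 0 \<le> f t"
    and f_total: "(\<integral>\<^sup>+t. ennreal (f t) \<partial>lborel) = 1"
    and f_support: "closure {t. f t \<noteq> 0} = {a..}"
    and f_continuous: "continuous_on {a<..} f"
begin

definition \<mu> :: "real measure" where
  "\<mu> = density lborel (\<lambda>t. ennreal (f t))"

lemma sets_mu[measurable_cong]: "sets \<mu> = sets borel"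
  by (simp add: \<mu>_def)

lemma f_zero: "t < a \<Longrightarrow> f t = 0"
proof (rule ccontr)
  assume "t < a" "f t \<noteq> 0"
  then have "t \<in> closure {t. f t \<noteq> 0}" by (intro subsetD[OF closure_subset]) simp
  then show False using f_support \<open>t < a\<close> by simp
qed

lemma f_nonzero: "f t \<noteq> 0 \<Longrightarrow> a \<le> t"
  using f_zero[of t] by linarith

lemma AE_mu_ge: "AE x in \<mu>. a \<le> x"
  unfolding \<mu>_def by (subst AE_density) (auto intro!: AE_I2 f_nonzero)

lemma nonneg_law_mu: "nonneg_law \<mu>"
proof (rule nonneg_lawI)
  show "prob_space \<mu>" by rule (simp add: \<mu>_def emeasure_density f_total)
  show "AE x in \<mu>. 0 \<le> x" using AE_mu_ge by eventually_elim (use a_nonneg in auto)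
qed (simp add: \<mu>_def)

lemma isCont_f: "a < t \<Longrightarrow> isCont f t"
  using f_continuous by (simp add: continuous_on_eq_continuous_at)

text \<open>The support is a closure, so by itself it only provides a point t in the interval with f
  t > 0; continuity at t turns this into positive mass.\<close>

lemma mu_near_a:
  assumes d: "0 < d"
  shows "0 < emeasure \<mu> {a<..<a + d}"
proof (rule ccontr)
  assume "\<not> 0 < emeasure \<mu> {a<..<a + d}"
  then have "(\<integral>\<^sup>+t. ennreal (f t) * indicator {a<..<a + d} t \<partial>lborel) = 0"
    by (simp add: \<mu>_def emeasure_density)
  then have ae: "AE t in lborel. ennreal (f t) * indicator {a<..<a + d} t = 0"
    by (subst (asm) nn_integral_0_iff_AE) auto
  have "a + d / 2 \<in> {a<..<a + d} \<inter> closure {t. f t \<noteq> 0}" using f_support d by simp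
  then have "{a<..<a + d} \<inter> closure {t. f t \<noteq> 0} \<noteq> {}" by blast
  then have "{a<..<a + d} \<inter> {t. f t \<noteq> 0} \<noteq> {}" by (subst (asm) open_Int_closure_eq_empty) auto
  then obtain t where t: "a < t" "t < a + d" "0 < f t" using f_nonneg by (force simp: order.strict_iff_order)
  have "AE x in lborel. t < x \<longrightarrow> x < a + d \<longrightarrow> f x = 0"
    using ae by eventually_elim (use t f_nonneg in \<open>auto simp: ennreal_eq_0_iff order.antisym\<close>)
  then show False using isCont_AE_zero[OF isCont_f[OF t(1)] t(2)] t(3) by simp
qed

lemma moment_density:
  assumes l: "0 < l"
  shows "(\<integral>\<^sup>+t. ennreal (exp (- (l * t))) * ennreal (t * f t) \<partial>lborel) = ennreal (laplace_moment \<mu> l)"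
proof -
  have "ennreal (laplace_moment \<mu> l) = (\<integral>\<^sup>+x. ennreal (x * exp (- (l * x))) \<partial>\<mu>)"
    unfolding laplace_moment_def
    by (rule nn_integral_eq_integral[symmetric, OF laplace_moment_integrable[OF nonneg_law_mu l]])
      (use nonneg_lawD(4)[OF nonneg_law_mu] in \<open>auto elim: eventually_mono\<close>)
  also have "\<dots> = (\<integral>\<^sup>+t. ennreal (f t) * ennreal (t * exp (- (l * t))) \<partial>lborel)"
    unfolding \<mu>_def by (rule nn_integral_density) auto
  also have "\<dots> = (\<integral>\<^sup>+t. ennreal (exp (- (l * t))) * ennreal (t * f t) \<partial>lborel)"
  proof (rule nn_integral_cong)
    fix t
    show "ennreal (f t) * ennreal (t * exp (- (l * t))) = ennreal (exp (- (l * t))) * ennreal (t * f t)"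
    proof (cases "0 \<le> t")
      case True
      then show ?thesis using f_nonneg[of t] by (simp add: ennreal_mult[symmetric] ac_simps)
    next
      case False
      then show ?thesis using f_zero[of t] a_nonneg by simp
    qed
  qed
  finally show ?thesis by simp
qed

lemma laplace_density:
  assumes l: "0 \<le> l"
  shows "(\<integral>\<^sup>+t. ennreal (exp (- (l * t))) * ennreal (f t) \<partial>lborel) = ennreal (laplace \<mu> l)"
proof -
  have "ennreal (laplace \<mu> l) = (\<integral>\<^sup>+t. ennreal (f t) * ennreal (exp (- (l * t))) \<partial>lborel)"
    using lap_eq_laplace[OF nonneg_law_mu l] unfolding lap_def \<mu>_def
    by (simp add: nn_integral_density)
  then show ?thesis by (simp add: mult.commute)
qed

lemma laplace_moment_ge:
  assumes l: "0 < l"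
  shows "a * laplace \<mu> l \<le> laplace_moment \<mu> l"
proof -
  have "(\<integral>x. a * exp (- (l * x)) \<partial>\<mu>) \<le> (\<integral>x. x * exp (- (l * x)) \<partial>\<mu>)"
    by (rule integral_mono_AE)
      (use AE_mu_ge laplace_integrable[OF nonneg_law_mu] laplace_moment_integrable[OF nonneg_law_mu l] l in
        \<open>auto elim!: eventually_mono intro: mult_right_mono\<close>)
  then show ?thesis by (simp add: laplace_def laplace_moment_def)
qed

lemma laplace_moment_pos:
  assumes l: "0 < l"
  shows "0 < laplace_moment \<mu> l"
proof (rule ccontr)
  assume "\<not> 0 < laplace_moment \<mu> l"
  then have "(\<integral>\<^sup>+t. ennreal (exp (- (l * t))) * ennreal (t * f t) \<partial>lborel) = 0"
    using moment_density[OF l] by (simp add: ennreal_neg)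
  then have "AE t in lborel. ennreal (exp (- (l * t))) * ennreal (t * f t) = 0"
    by (subst (asm) nn_integral_0_iff_AE) auto
  then have "AE t in lborel. ennreal (f t) = 0"
    using AE_lborel_singleton[of 0]
  proof eventually_elim
    case (elim t)
    then have "t * f t \<le> 0" by (simp add: ennreal_eq_0_iff)
    then show ?case using elim f_zero[of t] f_nonneg[of t] a_nonneg
      by (cases "t < 0") (auto simp: mult_le_0_iff not_less)
  qed
  then have "(\<integral>\<^sup>+t. ennreal (f t) \<partial>lborel) = 0" by (subst nn_integral_0_iff_AE) auto
  then show False using f_total by simp
qed

section \<open>The integral equation under the Laplace transform\<close>

context
  fixes \<nu> :: "real measure"
  assumes levy: "subordinator_levy_measure \<nu>"
begin

lemma tail_meas[measurable]: "tail \<nu> \<in> borel_measurable borel"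
  by (rule borel_measurable_tail[OF levy])

lemma conv_meas[measurable]: "tail_convolution \<nu> f \<in> borel_measurable borel"
  by (rule borel_measurable_tail_convolution[OF levy]) measurable

lemma tail_convolution_zero:
  assumes "t < a"
  shows "tail_convolution \<nu> f t = 0"
proof -
  have "tail_convolution \<nu> f t = (\<integral>\<^sup>+(s::real). 0 \<partial>lborel)"
    unfolding tail_convolution_def
  proof (rule nn_integral_cong)
    fix s show "tail \<nu> (t - s) * ennreal (f s) = 0"
      using assms f_zero[of s] by (cases "s < t") (auto simp: tail_def)
  qed
  then show ?thesis by simp
qed

lemma laplace_tail_convolution:
  assumes l: "0 < l"
  shows "(\<integral>\<^sup>+t. ennreal (exp (- (l * t))) * tail_convolution \<nu> f t \<partial>lborel)
    = ennreal (bernstein_real \<nu> l / l * laplace \<mu> l)"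
proof -
  have "(\<integral>\<^sup>+t. ennreal (exp (- (l * t))) * tail_convolution \<nu> f t \<partial>lborel)
     = ennreal (1 / l) * bernstein \<nu> l * ennreal (laplace \<mu> l)"
    unfolding tail_convolution_def using l
    by (subst nn_integral_exp_convolution) (auto simp: nn_integral_exp_tail[OF levy] laplace_density)
  also have "\<dots> = ennreal (bernstein_real \<nu> l / l * laplace \<mu> l)"
    using l laplace_pos[OF nonneg_law_mu, of l] ennreal_bernstein_real[OF levy l, symmetric]
    by (simp add: ennreal_mult[symmetric])
  finally show ?thesis .
qed

text \<open>The integral against the strictly positive weight exp (- t) is finite.\<close>

lemma AE_tail_convolution_finite: "AE t in lborel. tail_convolution \<nu> f t < \<infinity>"
proof -
  have "AE t in lborel. ennreal (exp (- (1 * t))) * tail_convolution \<nu> f t \<noteq> \<infinity>"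
    by (rule nn_integral_PInf_AE) (use laplace_tail_convolution[of 1] in auto)
  then show ?thesis
    by eventually_elim (auto simp: ennreal_mult_eq_top_iff less_top)
qed

lemma laplace_of_density_equation:
  assumes b: "0 \<le> b" and l: "0 < l"
  shows "(\<integral>\<^sup>+t. ennreal (exp (- (l * t))) * (ennreal (b * f t) + tail_convolution \<nu> f t) \<partial>lborel)
    = ennreal ((b + bernstein_real \<nu> l / l) * laplace \<mu> l)"
proof -
  have "(\<integral>\<^sup>+t. ennreal (exp (- (l * t))) * (ennreal (b * f t) + tail_convolution \<nu> f t) \<partial>lborel)
     = (\<integral>\<^sup>+t. ennreal b * (ennreal (exp (- (l * t))) * ennreal (f t)) + ennreal (exp (- (l * t))) * tail_convolution \<nu> f t \<partial>lborel)"
    using b f_nonneg by (intro nn_integral_cong) (simp add: distrib_left ennreal_mult ac_simps)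
  also have "\<dots> = (\<integral>\<^sup>+t. ennreal b * (ennreal (exp (- (l * t))) * ennreal (f t)) \<partial>lborel)
      + (\<integral>\<^sup>+t. ennreal (exp (- (l * t))) * tail_convolution \<nu> f t \<partial>lborel)"
    by (rule nn_integral_add) auto
  also have "(\<integral>\<^sup>+t. ennreal b * (ennreal (exp (- (l * t))) * ennreal (f t)) \<partial>lborel) = ennreal (b * laplace \<mu> l)"
    using b l laplace_pos[OF nonneg_law_mu, of l]
    by (subst nn_integral_cmult) (auto simp: laplace_density ennreal_mult)
  also have "ennreal (b * laplace \<mu> l) + (\<integral>\<^sup>+t. ennreal (exp (- (l * t))) * tail_convolution \<nu> f t \<partial>lborel)
    = ennreal ((b + bernstein_real \<nu> l / l) * laplace \<mu> l)"
    unfolding laplace_tail_convolution[OF l]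
    using b l laplace_pos[OF nonneg_law_mu, of l]
    by (simp add: ennreal_plus[symmetric] distrib_right del: ennreal_plus)
  finally show ?thesis .
qed

lemma density_equation_imp_log_derivative:
  assumes b: "0 \<le> b"
    and ae: "AE t in lborel. ennreal (t * f t) = ennreal (b * f t) + tail_convolution \<nu> f t"
  shows "log_derivative \<mu> b \<nu>"
  unfolding log_derivative_def
proof (intro allI impI)
  fix l :: real assume l: "0 < l"
  have "ennreal (laplace_moment \<mu> l)
     = (\<integral>\<^sup>+t. ennreal (exp (- (l * t))) * (ennreal (b * f t) + tail_convolution \<nu> f t) \<partial>lborel)"
    unfolding moment_density[OF l, symmetric]
    by (rule nn_integral_cong_AE) (use ae in eventually_elim, simp)
  then have "ennreal (laplace_moment \<mu> l) = ennreal ((b + bernstein_real \<nu> l / l) * laplace \<mu> l)"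
    unfolding laplace_of_density_equation[OF b l] .
  then show "laplace_moment \<mu> l = (b + bernstein_real \<nu> l / l) * laplace \<mu> l"
    using laplace_moment_pos[OF l] laplace_pos[OF nonneg_law_mu, of l] b l by (subst (asm) ennreal_inj) auto
qed

text \<open>The two sides are densities of measures with equal transforms at the positive integers.
  These measures coincide, and sigma-finiteness makes their densities agree almost
  everywhere.\<close>

lemma log_derivative_imp_density_equation:
  assumes b: "0 \<le> b"
    and ld: "\<And>n::nat. 1 \<le> n \<Longrightarrow> laplace_moment \<mu> (real n) = (b + bernstein_real \<nu> (real n) / real n) * laplace \<mu> (real n)"
  shows "AE t in lborel. ennreal (t * f t) = ennreal (b * f t) + tail_convolution \<nu> f t"
proof -
  define M1 where "M1 = density lborel (\<lambda>t. ennreal (t * f t))"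
  define M2 where "M2 = density lborel (\<lambda>t. ennreal (b * f t) + tail_convolution \<nu> f t)"
  have lap1: "lap M1 l = ennreal (laplace_moment \<mu> l)" if l: "0 < l" for l
    unfolding lap_def M1_def using moment_density[OF l] by (subst nn_integral_density) (auto simp: mult.commute)
  have lap2: "lap M2 l = ennreal ((b + bernstein_real \<nu> l / l) * laplace \<mu> l)" if l: "0 < l" for l
    unfolding lap_def M2_def using laplace_of_density_equation[OF b l]
    by (subst nn_integral_density) (auto simp: mult.commute)
  have "M1 = M2"
  proof (rule lap_determines_measure)
    have neg: "t < 0 \<Longrightarrow> f t = 0" "t < 0 \<Longrightarrow> tail_convolution \<nu> f t = 0" for t
      using f_zero[of t] tail_convolution_zero[of t] a_nonneg by auto
    show "AE x in M1. 0 \<le> x"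
      unfolding M1_def using neg(1) by (subst AE_density) (measurable, intro AE_I2, force simp: not_le[symmetric])
    show "AE x in M2. 0 \<le> x"
      unfolding M2_def using neg by (subst AE_density) (measurable, intro AE_I2, force simp: not_le[symmetric])
    show "lap M1 1 < \<infinity>" by (simp add: lap1)
    fix n :: nat assume n: "1 \<le> n"
    then show "lap M1 (real n) = lap M2 (real n)" using ld[OF n] by (simp add: lap1 lap2)
  qed (simp_all add: M1_def M2_def)
  moreover have "sigma_finite_measure M1"
    unfolding M1_def by (subst sigma_finite_measure.sigma_finite_iff_density_finite[OF lborel.sigma_finite_measure_axioms]) auto
  ultimately show ?thesis
    unfolding M1_def M2_def by (subst (asm) sigma_finite_density_unique) auto
qed

text \<open>This holds even if the integral diverges, since the Bochner integral and
  \<open>enn2real\<close> then both return 0. For s < t the tail is finite, so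
  \<open>measure\<close> loses nothing.\<close>

lemma interval_integral_eq_tail_convolution:
  assumes t: "a \<le> t"
  shows "(LBINT s=a..t. measure \<nu> {t - s<..} * f s) = enn2real (tail_convolution \<nu> f t)"
proof -
  have eq: "indicator {a<..<t} s *\<^sub>R (measure \<nu> {t - s<..} * f s) = indicator {a<..<t} s * (enn2real (tail \<nu> (t - s)) * f s)" for s
    by (simp add: tail_def measure_def split: split_indicator)
  have "(LBINT s=a..t. measure \<nu> {t - s<..} * f s) = (\<integral>s. indicator {a<..<t} s * (enn2real (tail \<nu> (t - s)) * f s) \<partial>lborel)"
    using t by (simp add: interval_lebesgue_integral_le_eq set_lebesgue_integral_def eq[unfolded real_scaleR_def])
  also have "\<dots> = enn2real (\<integral>\<^sup>+s. ennreal (indicator {a<..<t} s * (enn2real (tail \<nu> (t - s)) * f s)) \<partial>lborel)"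
    using f_nonneg by (intro integral_eq_nn_integral) auto
  also have "(\<integral>\<^sup>+s. ennreal (indicator {a<..<t} s * (enn2real (tail \<nu> (t - s)) * f s)) \<partial>lborel) = tail_convolution \<nu> f t"
    unfolding tail_convolution_def
  proof (rule nn_integral_cong_AE)
    show "AE s in lborel. ennreal (indicator {a<..<t} s * (enn2real (tail \<nu> (t - s)) * f s)) = tail \<nu> (t - s) * ennreal (f s)"
      using AE_lborel_singleton[of a]
    proof eventually_elim
      case (elim s)
      consider "s < a" | "t \<le> s" | "a < s" "s < t" using elim by linarith
      then show ?case
      proof cases
        case 1 then show ?thesis using f_zero by simp
      next
        case 2 then show ?thesis by (simp add: tail_def)
      next
        case 3
        have "ennreal (enn2real (tail \<nu> (t - s))) = tail \<nu> (t - s)" using tail_finite[OF levy, of "t - s"] by simp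
        then show ?thesis using 3 f_nonneg[of s] by (simp add: ennreal_mult)
      qed
    qed
  qed
  finally show ?thesis .
qed

text \<open>A divergent integral reads as 0 in the hypothesis, so the equation is informative only
  where the convolution is finite, which is almost everywhere.\<close>

lemma integral_equation_imp_density_equation:
  assumes eq: "\<forall>t\<ge>a. (a - t) * f t + (LBINT s=a..t. measure \<nu> {t - s<..} * f s) = 0"
  shows "AE t in lborel. ennreal (t * f t) = ennreal (a * f t) + tail_convolution \<nu> f t"
  using AE_tail_convolution_finite
proof eventually_elim
  case (elim t)
  show ?case
  proof (cases "t < a")
    case True
    then show ?thesis by (simp add: f_zero tail_convolution_zero)
  next
    case False
    then have t: "a \<le> t" by simp
    obtain j where j: "tail_convolution \<nu> f t = ennreal j" "0 \<le> j" using elim by (cases "tail_convolution \<nu> f t") auto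
    have "(a - t) * f t + (LBINT s=a..t. measure \<nu> {t - s<..} * f s) = 0" using eq t by blast
    then have "t * f t = a * f t + j"
      unfolding interval_integral_eq_tail_convolution[OF t] using j by (simp add: algebra_simps)
    then show ?thesis using j a_nonneg f_nonneg[of t] by (simp add: ennreal_plus)
  qed
qed

text \<open>If b > a, the equation gives (b - t) f(t) \<le> 0 and hence f = 0 almost everywhere on
  (a, b), against the support. In the other direction - \<phi>'(l) / \<phi>(l) \<ge> a, while K(l) /
  l tends to 0 as l grows, so a \<le> b.\<close>

lemma drift_eq:
  assumes b: "0 \<le> b" and ae: "AE t in lborel. ennreal (t * f t) = ennreal (b * f t) + tail_convolution \<nu> f t"
  shows "b = a"
proof (rule antisym)
  show "b \<le> a"
  proof (rule ccontr)
    assume "\<not> b \<le> a"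
    then have d: "0 < b - a" by simp
    have "AE t in lborel. ennreal (f t) * indicator {a<..<a + (b - a)} t = 0"
      using ae
    proof eventually_elim
      case (elim t)
      have "f t = 0" if "a < t" "t < b"
      proof -
        have "ennreal (b * f t) \<le> ennreal (t * f t)" using elim by simp
        then have "b * f t \<le> t * f t" using that a_nonneg f_nonneg[of t] by (subst (asm) ennreal_le_iff) auto
        then have "(b - t) * f t \<le> 0" by (simp add: algebra_simps)
        then show ?thesis using that f_nonneg[of t] by (simp add: mult_le_0_iff)
      qed
      then show ?case by (auto split: split_indicator)
    qed
    then have "emeasure \<mu> {a<..<a + (b - a)} = 0"
      unfolding \<mu>_def by (subst emeasure_density) (auto simp: nn_integral_0_iff_AE)
    then show False using mu_near_a[OF d] by simp
  qed
next
  have ld: "log_derivative \<mu> b \<nu>" by (rule density_equation_imp_log_derivative[OF b ae])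
  have [measurable_cong]: "sets \<nu> = sets borel" by (rule levy_sets[OF levy])
  have "a \<le> b + bernstein_real \<nu> (real (Suc n)) / real (Suc n)" for n
  proof -
    have p: "0 < real (Suc n)" by simp
    have "a * laplace \<mu> (real (Suc n)) \<le> (b + bernstein_real \<nu> (real (Suc n)) / real (Suc n)) * laplace \<mu> (real (Suc n))"
      using laplace_moment_ge[OF p] ld p unfolding log_derivative_def by metis
    then show ?thesis using laplace_pos[OF nonneg_law_mu, of "real (Suc n)"] by (simp del: of_nat_Suc)
  qed
  moreover have "(\<lambda>n. b + bernstein_real \<nu> (real (Suc n)) / real (Suc n)) \<longlonglongrightarrow> b + 0"
  proof (intro tendsto_intros)
    \<comment> \<open>The absolute value fixes the sign at x < 0, which \<nu> does not
      charge.\<close>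
    have int: "integrable \<nu> (\<lambda>x. \<bar>min 1 x\<bar>)"
    proof (rule integrableI_nonneg)
      have "(\<integral>\<^sup>+x. ennreal \<bar>min 1 x\<bar> \<partial>\<nu>) = (\<integral>\<^sup>+x. ennreal (min 1 x) \<partial>\<nu>)"
        by (rule nn_integral_cong_AE) (use levy_AE_pos[OF levy] in eventually_elim, simp)
      then show "(\<integral>\<^sup>+x. ennreal \<bar>min 1 x\<bar> \<partial>\<nu>) < \<infinity>" using levy_min_finite[OF levy] by simp
    qed auto
    have "(\<lambda>n. \<integral>x. (1 - exp (- (real (Suc n) * x))) / real (Suc n) \<partial>\<nu>) \<longlonglongrightarrow> (\<integral>x. 0 \<partial>\<nu>)"
    proof (rule integral_dominated_convergence[OF _ _ int])
      show "AE x in \<nu>. (\<lambda>n. (1 - exp (- (real (Suc n) * x))) / real (Suc n)) \<longlonglongrightarrow> 0"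
        using levy_AE_pos[OF levy]
      proof eventually_elim
        case (elim x)
        then show ?case by real_asymp
      qed
      show "AE x in \<nu>. norm ((1 - exp (- (real (Suc n) * x))) / real (Suc n)) \<le> \<bar>min 1 x\<bar>" for n
        using levy_AE_pos[OF levy]
      proof eventually_elim
        case (elim x)
        have "1 - exp (- (real (Suc n) * x)) \<le> max 1 (real (Suc n)) * min 1 x"
          by (rule one_minus_exp_le_min) (use elim in auto)
        also have "max 1 (real (Suc n)) = real (Suc n)" by simp
        finally have "(1 - exp (- (real (Suc n) * x))) / real (Suc n) \<le> min 1 x"
          by (subst pos_divide_le_eq) (simp_all only: mult.commute of_nat_0_less_iff zero_less_Suc)
        moreover have "0 \<le> 1 - exp (- (real (Suc n) * x))" using elim by simp
        ultimately show ?case using elim by simp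
      qed
    qed auto
    moreover have "(\<integral>x. (1 - exp (- (real (Suc n) * x))) / real (Suc n) \<partial>\<nu>) = bernstein_real \<nu> (real (Suc n)) / real (Suc n)" for n
    proof -
      have "(\<integral>x. 1 - exp (- (real (Suc n) * x)) \<partial>\<nu>) = bernstein_real \<nu> (real (Suc n))"
        unfolding bernstein_real_def bernstein_def
        by (rule integral_eq_nn_integral) (use levy_AE_pos[OF levy] in \<open>auto elim: eventually_mono\<close>)
      then show ?thesis by simp
    qed
    ultimately show "(\<lambda>n. bernstein_real \<nu> (real (Suc n)) / real (Suc n)) \<longlonglongrightarrow> 0" by simp
  qed
  ultimately show "a \<le> b" by (intro LIMSEQ_le_const) auto
qed

end

lemma selfdecomposable_imp_density_equation:
  assumes sd: "selfdecomposable \<mu>"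
  obtains \<nu> where "subordinator_levy_measure \<nu>"
    "AE t in lborel. ennreal (t * f t) = ennreal (a * f t) + tail_convolution \<nu> f t"
proof -
  have null: "emeasure \<mu> {..<a} = 0"
    using AE_mu_ge by (subst (asm) AE_iff_measurable[of "{..<a}"]) (auto simp: sets_mu sets_eq_imp_space_eq[OF sets_mu])
  have inf: "0 < emeasure \<mu> {..<a + d}" if "0 < d" for d
  proof -
    have "emeasure \<mu> {a<..<a + d} \<le> emeasure \<mu> {..<a + d}" by (rule emeasure_mono) (auto simp: sets_mu)
    then show ?thesis using mu_near_a[OF that] by simp
  qed
  have dec: "\<exists>P. nonneg_law P \<and> (\<forall>l>0. laplace \<mu> (l * c) * laplace P l = laplace \<mu> l)" if c: "0 < c" "c < 1" for c
  proof -
    have "c \<in> {0<..<1}" using c by simp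
    then obtain P where P: "real_distribution P" "(scaled c \<mu> \<star> P) = \<mu>"
      using sd unfolding selfdecomposable_iff_convolution by blast
    have nP: "nonneg_law P" by (rule nonneg_law_deconvolution[OF nonneg_law_mu a_nonneg null inf c P])
    have S: "nonneg_law (scaled c \<mu>)" using c by (intro nonneg_law_scaled nonneg_law_mu) simp
    have "laplace \<mu> (l * c) * laplace P l = laplace \<mu> l" if "0 < l" for l
      using laplace_convolution[OF S nP, of l] that by (simp add: P(2) laplace_scaled[OF sets_mu])
    then show ?thesis using nP by blast
  qed
  define k where "k = (\<lambda>l. l * laplace_moment \<mu> l / laplace \<mu> l)"
  obtain Q where Q: "nonneg_law Q" "\<And>l. 0 < l \<Longrightarrow> k (l + 1) = k l + k 1 * laplace Q l"
    using limit_of_selfdecomposition[OF nonneg_law_mu laplace_moment_pos dec] unfolding k_def by metis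
  have k1: "0 < k 1" unfolding k_def using laplace_moment_pos[of 1] laplace_pos[OF nonneg_law_mu, of 1] by simp
  obtain \<nu> b where levy: "subordinator_levy_measure \<nu>" and b: "0 \<le> b"
    and kn: "\<And>n::nat. 1 \<le> n \<Longrightarrow> k (real n) = b * real n + bernstein_real \<nu> (real n)"
    using levy_khintchine_of_difference_equation[OF Q(1) k1 Q(2)] by metis
  have "laplace_moment \<mu> (real n) = (b + bernstein_real \<nu> (real n) / real n) * laplace \<mu> (real n)" if n: "1 \<le> n" for n :: nat
    using kn[OF n] laplace_pos[OF nonneg_law_mu, of n] n unfolding k_def by (simp add: field_simps)
  then have ae: "AE t in lborel. ennreal (t * f t) = ennreal (b * f t) + tail_convolution \<nu> f t"
    by (rule log_derivative_imp_density_equation[OF levy b])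
  have "b = a" by (rule drift_eq[OF levy b ae])
  then show thesis using that levy ae by blast
qed

end

section \<open>The logarithmic moment of the Levy measure\<close>

text \<open>For x \<ge> 1, ln x is the integral of 1 / v over 1 / x \<le> v \<le> 1, and there 1 -
  exp (- v x) \<ge> 1 / 2. Half of the logarithmic moment is therefore bounded by integrals of K(v)
  / v over [c, 1], which stay below - ln \<phi>(1).\<close>

lemma log_moment_finite:
  assumes M: "nonneg_law M" and levy: "subordinator_levy_measure \<nu>" and b: "0 \<le> b"
    and ld: "log_derivative M b \<nu>"
  shows "(\<integral>\<^sup>+x\<in>{0<..}. ennreal (ln_plus x) \<partial>\<nu>) < \<infinity>"
proof -
  interpret nu: sigma_finite_measure \<nu> by (rule levy_sigma_finite[OF levy])
  interpret pair_sigma_finite lborel \<nu> ..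
  have [measurable_cong]: "sets \<nu> = sets borel" by (rule levy_sets[OF levy])
  have [measurable]: "ln_plus \<in> borel_measurable borel" unfolding ln_plus_def by measurable
  define C where "C = ennreal (- ln (laplace M 1))"
  \<comment> \<open>The cut at n + 1 matches c = 1 / (n + 1): it ensures that [1 / x, 1] lies inside
    [c, 1]. Monotone convergence removes it at the end.\<close>
  define F where "F n x = ennreal (1 / 2) * (ennreal (ln_plus x) * indicator {0<..real (Suc n)} x)" for n x
  have F_meas[measurable]: "F n \<in> borel_measurable \<nu>" for n unfolding F_def by measurable
  have le: "(\<integral>\<^sup>+x. F n x \<partial>\<nu>) \<le> C" for n
  proof -
    define c where "c = 1 / real (Suc n)"
    have c: "0 < c" "c \<le> 1" by (auto simp: c_def)
    have "(\<integral>\<^sup>+x. F n x \<partial>\<nu>) \<le> (\<integral>\<^sup>+x. \<integral>\<^sup>+v. ennreal (1 / v) * indicator {c..1} v * ennreal (1 - exp (- (v * x))) \<partial>lborel \<partial>\<nu>)"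
    proof (rule nn_integral_mono)
      fix x
      show "F n x \<le> (\<integral>\<^sup>+v. ennreal (1 / v) * indicator {c..1} v * ennreal (1 - exp (- (v * x))) \<partial>lborel)"
      proof (cases "1 \<le> x \<and> x \<le> real (Suc n)")
        case True
        then have x: "1 \<le> x" "x \<le> real (Suc n)" by auto
        have cx: "c \<le> 1 / x" unfolding c_def using x by (intro divide_left_mono) auto
        have "F n x = ennreal (1 / 2) * ennreal (ln 1 - ln (1 / x))"
          using x by (simp add: F_def ln_plus_def ln_div max_def)
        also have "ennreal (ln 1 - ln (1 / x)) = (\<integral>\<^sup>+v. ennreal (1 / v) * indicator {1 / x..1} v \<partial>lborel)"
        proof (rule nn_integral_FTC_Icc[symmetric])
          fix v assume "v \<in> {1 / x..1}"
          then have "0 < v" using x by (auto intro: less_le_trans[of 0 "1/x"])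
          then show "(ln has_real_derivative 1 / v) (at v)" "0 \<le> 1 / v" by (auto intro!: derivative_eq_intros)
        qed (use x in auto)
        also have "ennreal (1 / 2) * \<dots> = (\<integral>\<^sup>+v. ennreal (1 / 2) * (ennreal (1 / v) * indicator {1 / x..1} v) \<partial>lborel)"
          by (rule nn_integral_cmult[symmetric]) measurable
        also have "\<dots> \<le> (\<integral>\<^sup>+v. ennreal (1 / v) * indicator {c..1} v * ennreal (1 - exp (- (v * x))) \<partial>lborel)"
        proof (rule nn_integral_mono)
          fix v
          show "ennreal (1 / 2) * (ennreal (1 / v) * indicator {1 / x..1} v) \<le> ennreal (1 / v) * indicator {c..1} v * ennreal (1 - exp (- (v * x)))"
          proof (cases "v \<in> {1 / x..1}")
            case v: True
            then have "1 \<le> v * x" using x by (simp add: field_simps)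
            then have "1 / 2 \<le> 1 - exp (- (v * x))" using one_minus_exp_ge_min[of "v * x"] by simp
            then have "ennreal (1 / v) * ennreal (1 / 2) \<le> ennreal (1 / v) * ennreal (1 - exp (- (v * x)))"
              by (intro mult_left_mono ennreal_leI) auto
            then show ?thesis using v cx by (auto simp: mult.commute)
          qed simp
        qed
        finally show ?thesis .
      next
        case False
        then have "F n x = 0" by (auto simp: F_def ln_plus_def max_def split: split_indicator)
        then show ?thesis by simp
      qed
    qed
    also have "\<dots> = (\<integral>\<^sup>+v. \<integral>\<^sup>+x. ennreal (1 / v) * indicator {c..1} v * ennreal (1 - exp (- (v * x))) \<partial>\<nu> \<partial>lborel)"
      by (rule Fubini') measurable
    also have "\<dots> = (\<integral>\<^sup>+v. ennreal (1 / v) * indicator {c..1} v * bernstein \<nu> (1 * v) \<partial>lborel)"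
      unfolding bernstein_def by (intro nn_integral_cong) (simp add: nn_integral_cmult)
    also have "\<dots> \<le> ennreal (1 * b * (1 - c)) + (\<integral>\<^sup>+v. ennreal (1 / v) * indicator {c..1} v * bernstein \<nu> (1 * v) \<partial>lborel)"
      by simp
    also have "\<dots> = ennreal (ln (laplace M (1 * c)) - ln (laplace M 1))"
      by (rule log_derivative_integral[OF M levy b ld c]) simp
    also have "\<dots> \<le> C"
    proof -
      have "laplace M c \<le> laplace M 0" using c by (intro laplace_antimono[OF M]) auto
      also have "laplace M 0 = 1"
        using prob_space.prob_space[OF nonneg_lawD(1)[OF M]] by (simp add: laplace_def)
      finally have "ln (laplace M c) \<le> 0" using laplace_pos[OF M, of c] c by simp
      then show ?thesis unfolding C_def by (intro ennreal_leI) simp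
    qed
    finally show ?thesis .
  qed
  define G where "G x = ennreal (1 / 2) * (ennreal (ln_plus x) * indicator {0<..} x)" for x
  have "(\<lambda>n. \<integral>\<^sup>+x. F n x \<partial>\<nu>) \<longlonglongrightarrow> (\<integral>\<^sup>+x. G x \<partial>\<nu>)"
  proof (rule nn_integral_LIMSEQ)
    show "incseq F"
      by (rule incseq_SucI) (auto simp: F_def le_fun_def intro!: mult_left_mono split: split_indicator)
    fix x
    obtain N where "x < real N" using reals_Archimedean2 by blast
    then have "\<forall>n\<ge>N. F n x = G x" by (auto simp: F_def G_def split: split_indicator)
    then show "(\<lambda>n. F n x) \<longlonglongrightarrow> G x" by (intro tendsto_eventually) (auto simp: eventually_sequentially)
  qed simp
  then have "(\<integral>\<^sup>+x. G x \<partial>\<nu>) \<le> C" by (rule LIMSEQ_le_const2) (use le in auto)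
  also have "(\<integral>\<^sup>+x. G x \<partial>\<nu>) = ennreal (1 / 2) * (\<integral>\<^sup>+x\<in>{0<..}. ennreal (ln_plus x) \<partial>\<nu>)"
    unfolding G_def by (rule nn_integral_cmult) measurable
  finally have "ennreal (1 / 2) * (\<integral>\<^sup>+x\<in>{0<..}. ennreal (ln_plus x) \<partial>\<nu>) < \<infinity>"
    by (rule le_less_trans) (simp add: C_def)
  then show ?thesis by (auto simp: ennreal_mult_less_top)
qed

section \<open>Continuity of the convolution and the equation at every point\<close>

context half_line_density
begin

context
  fixes \<nu> :: "real measure"
  assumes levy: "subordinator_levy_measure \<nu>"
begin

text \<open>On (0, T] the factor exp (T - u) is at least 1, so finiteness of the transform of the
  tail at l = 1 suffices.\<close>

lemma tail_integrable_near_0: "integrable lborel (\<lambda>u. indicator {0<..T} u * enn2real (tail \<nu> u))"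
proof (rule integrableI_nonneg)
  have [measurable]: "tail \<nu> \<in> borel_measurable borel" by (rule borel_measurable_tail[OF levy])
  show "(\<lambda>u. indicator {0<..T} u * enn2real (tail \<nu> u)) \<in> borel_measurable lborel" by measurable
  have "(\<integral>\<^sup>+u. ennreal (indicator {0<..T} u * enn2real (tail \<nu> u)) \<partial>lborel)
    \<le> (\<integral>\<^sup>+u. ennreal (exp T) * (ennreal (exp (- (1 * u))) * tail \<nu> u) \<partial>lborel)"
  proof (rule nn_integral_mono)
    fix u
    have t: "ennreal (enn2real (tail \<nu> u)) = tail \<nu> u" using tail_finite[OF levy, of u] by simp
    have "1 * tail \<nu> u \<le> ennreal (exp T * exp (- u)) * tail \<nu> u" if "u \<le> T"
      using that by (intro mult_right_mono) (auto simp: mult_exp_exp)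
    then show "ennreal (indicator {0<..T} u * enn2real (tail \<nu> u)) \<le> ennreal (exp T) * (ennreal (exp (- (1 * u))) * tail \<nu> u)"
      using t by (auto simp: ennreal_mult mult.assoc split: split_indicator)
  qed
  also have "\<dots> = ennreal (exp T) * (ennreal (1 / 1) * bernstein \<nu> 1)"
    by (subst nn_integral_cmult) (use nn_integral_exp_tail[OF levy, of 1] in auto)
  also have "\<dots> < \<infinity>" using bernstein_finite[OF levy, of 1] by (simp add: ennreal_mult_less_top)
  finally show "(\<integral>\<^sup>+u. ennreal (indicator {0<..T} u * enn2real (tail \<nu> u)) \<partial>lborel) < \<infinity>" .
qed auto

lemma integrable_f: "integrable lborel f"
  by (rule integrableI_nonneg) (use f_nonneg f_total in auto)

text \<open>
  Splitting at a point \<open>m\<close> strictly between \<open>a\<close> and \<open>t\<close> separates the possible singularity of \<open>f\<close>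
  at \<open>a\<close> from that of the tail of \<open>\<nu>\<close> at \<open>0\<close>, so that dominated convergence applies to each part.
\<close>

lemma tail_convolution_continuous:
  assumes t0: "a < t0"
  shows "tail_convolution \<nu> f t0 < \<infinity>"
    and "isCont (\<lambda>t. enn2real (tail_convolution \<nu> f t)) t0"
proof -
  have [measurable]: "tail \<nu> \<in> borel_measurable borel" by (rule borel_measurable_tail[OF levy])
  define m where "m = (a + t0) / 2"
  have m: "a < m" "m < t0" using t0 by (auto simp: m_def)
  define d where "d = (t0 - m) / 2"
  have d: "0 < d" "m + d < t0" using m(2) by (auto simp: d_def field_simps)
  \<comment> \<open>For t in this neighbourhood and s \<le> m one has t - s > d, which keeps the
    tail away from its singularity at 0.\<close>
  define U where "U = {m + d<..<t0 + d}"
  have U: "open U" "t0 \<in> U" using d by (auto simp: U_def)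
  define g where "g u = enn2real (tail \<nu> u)" for u
  have g0: "0 \<le> g u" for u by (simp add: g_def)
  have gt: "tail \<nu> u = ennreal (g u)" for u unfolding g_def using tail_finite[OF levy, of u] by simp
  have [measurable]: "g \<in> borel_measurable borel" unfolding g_def by measurable
  \<comment> \<open>The tail frozen below d: it is bounded and still antimonotone, and it agrees
    with the tail at all arguments t - s that matter.\<close>
  define h where "h y = g (max d y)" for y
  have h_anti: "h y \<le> h x" if "x \<le> y" for x y
  proof -
    have "tail \<nu> (max d y) \<le> tail \<nu> (max d x)"
      using that d by (auto simp: tail_def levy_sets[OF levy] intro!: emeasure_mono)
    then show ?thesis unfolding h_def gt using g0 by simp
  qed
  have h_le: "h y \<le> g d" for y
    using h_anti[of "min y d" y] by (simp add: h_def)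
  have [measurable]: "h \<in> borel_measurable borel" unfolding h_def by measurable
  have "compact (f ` {m..t0 + d})"
    by (intro compact_continuous_image continuous_on_subset[OF f_continuous]) (use m in auto)
  then obtain B where "\<forall>y\<in>f ` {m..t0 + d}. \<bar>y\<bar> \<le> B"
    using compact_imp_bounded bounded_real by metis
  then have B: "f t \<le> B" if "t \<in> {m..t0 + d}" for t
    using that abs_le_D1 by (meson imageI)
  define J1 where "J1 t s = indicator {..m} s * (h (t - s) * f s)" for t s
  \<comment> \<open>The part s > m after the substitution u = t - s. The parameter t now sits in f,
    which is bounded and continuous on [m, t0 + d], and no longer in the singular tail.\<close>
  define J2 where "J2 t u = indicator {..<t - m} u * (g u * f (t - u))" for t u
  have J1_meas[measurable]: "J1 t \<in> borel_measurable borel" for t unfolding J1_def by measurable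
  have J2_meas[measurable]: "J2 t \<in> borel_measurable borel" for t unfolding J2_def by measurable
  have nn: "0 \<le> J1 t s" "0 \<le> J2 t s" for t s
    unfolding J1_def J2_def h_def using g0 f_nonneg by auto
  define w1 where "w1 s = g d * f s" for s
  define w2 where "w2 u = B * (indicator {0<..t0 + d - m} u * g u)" for u
  have w1: "integrable lborel w1" unfolding w1_def using integrable_f by simp
  have w2: "integrable lborel w2"
    unfolding w2_def g_def using tail_integrable_near_0 by simp
  have b1: "norm (J1 t s) \<le> w1 s" for t s
    using mult_right_mono[OF h_le f_nonneg] nn(1)[of t s] f_nonneg[of s] g0[of d]
    by (auto simp: J1_def w1_def split: split_indicator)
  have b2: "norm (J2 t u) \<le> w2 u" if t: "t \<in> U" for t u
  proof (cases "0 < u \<and> u < t - m")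
    case True
    then have "f (t - u) \<le> B" using B[of "t - u"] t by (auto simp: U_def)
    then have "g u * f (t - u) \<le> g u * B" using g0 by (intro mult_left_mono)
    then show ?thesis using True t nn(2)[of t u] by (auto simp: J2_def w2_def U_def mult.commute)
  next
    case False
    have "0 \<le> w2 u" using B[of t0] f_nonneg[of t0] m d g0[of u] by (auto simp: w2_def split: split_indicator)
    moreover have "J2 t u = 0" using False by (auto simp: J2_def g_def tail_def split: split_indicator)
    ultimately show ?thesis by simp
  qed
  have i1: "integrable lborel (J1 t)" for t
    by (rule Bochner_Integration.integrable_bound[OF w1]) (simp, intro AE_I2 order.trans[OF b1], simp)
  have i2: "integrable lborel (J2 t)" if "t \<in> U" for t
    by (rule Bochner_Integration.integrable_bound[OF w2]) (simp, intro AE_I2 order.trans[OF b2[OF that]], simp)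
  define J where "J t = (\<integral>s. J1 t s \<partial>lborel) + (\<integral>u. J2 t u \<partial>lborel)" for t
  have J_eq: "tail_convolution \<nu> f t = ennreal (J t)" if t: "t \<in> U" for t
  proof -
    define H where "H s = indicator {m<..} s * (tail \<nu> (t - s) * ennreal (f s))" for s
    have [measurable]: "H \<in> borel_measurable borel" unfolding H_def by measurable
    have "tail_convolution \<nu> f t = (\<integral>\<^sup>+s. ennreal (J1 t s) + H s \<partial>lborel)"
      unfolding tail_convolution_def
    proof (rule nn_integral_cong)
      fix s
      show "tail \<nu> (t - s) * ennreal (f s) = ennreal (J1 t s) + H s"
      proof (cases "s \<le> m")
        case True
        then have "max d (t - s) = t - s" using t by (auto simp: U_def)
        then show ?thesis using True g0 f_nonneg by (simp add: J1_def H_def h_def gt ennreal_mult)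
      qed (simp add: J1_def H_def)
    qed
    also have "\<dots> = (\<integral>\<^sup>+s. ennreal (J1 t s) \<partial>lborel) + (\<integral>\<^sup>+s. H s \<partial>lborel)"
      by (rule nn_integral_add) auto
    also have "(\<integral>\<^sup>+s. H s \<partial>lborel) = (\<integral>\<^sup>+u. H (t + - 1 * u) \<partial>lborel)"
      by (subst nn_integral_real_affine[where c="-1" and t=t]) auto
    also have "\<dots> = (\<integral>\<^sup>+u. ennreal (J2 t u) \<partial>lborel)"
      using g0 f_nonneg by (intro nn_integral_cong) (auto simp: H_def J2_def gt ennreal_mult split: split_indicator)
    also have "(\<integral>\<^sup>+s. ennreal (J1 t s) \<partial>lborel) + (\<integral>\<^sup>+u. ennreal (J2 t u) \<partial>lborel) = ennreal (J t)"
      using i1[of t] i2[OF t] nn by (simp add: nn_integral_eq_integral J_def ennreal_plus)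
    finally show ?thesis .
  qed
  show "tail_convolution \<nu> f t0 < \<infinity>" using J_eq[OF U(2)] by simp
  have lim: "(\<lambda>n. J (X n)) \<longlonglongrightarrow> J t0" if XU: "\<And>n. X n \<in> U" and X: "X \<longlonglongrightarrow> t0" for X
    unfolding J_def
  proof (rule tendsto_add)
    \<comment> \<open>A monotone function has countably many discontinuities, so for almost every s
      the point t0 - s is a continuity point of h.\<close>
    define D where "D = {y. \<not> isCont (\<lambda>y. - h y) y}"
    have "countable D" unfolding D_def using h_anti by (intro mono_ctble_discont monoI) simp
    then have "(\<lambda>y. t0 - y) ` D \<in> null_sets lborel" by (intro countable_imp_null_set_lborel) auto
    then have aeD: "AE s in lborel. s \<notin> (\<lambda>y. t0 - y) ` D" by (rule AE_not_in)
    show "(\<lambda>n. \<integral>s. J1 (X n) s \<partial>lborel) \<longlonglongrightarrow> (\<integral>s. J1 t0 s \<partial>lborel)"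
    proof (rule integral_dominated_convergence[OF _ _ w1])
      show "AE s in lborel. (\<lambda>n. J1 (X n) s) \<longlonglongrightarrow> J1 t0 s"
        using aeD
      proof eventually_elim
        case (elim s)
        have "t0 - s \<notin> D"
        proof
          assume "t0 - s \<in> D"
          then have "t0 - (t0 - s) \<in> (\<lambda>y. t0 - y) ` D" by (rule imageI)
          then show False using elim by simp
        qed
        then have "isCont (\<lambda>y. - h y) (t0 - s)" by (simp add: D_def)
        then have "isCont h (t0 - s)" using continuous_minus[of "at (t0 - s)" "\<lambda>y. - h y"] by simp
        then have "(\<lambda>n. h (X n - s)) \<longlonglongrightarrow> h (t0 - s)"
          by (rule isCont_tendsto_compose) (intro tendsto_intros X)
        then show ?case unfolding J1_def by (intro tendsto_intros)
      qed
      show "AE s in lborel. norm (J1 (X n) s) \<le> w1 s" for n using b1 by simp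
    qed auto
    show "(\<lambda>n. \<integral>u. J2 (X n) u \<partial>lborel) \<longlonglongrightarrow> (\<integral>u. J2 t0 u \<partial>lborel)"
    proof (rule integral_dominated_convergence[OF _ _ w2])
      \<comment> \<open>The moving cut-off u < t - m can spoil convergence only at the single point
        u = t0 - m.\<close>
      show "AE u in lborel. (\<lambda>n. J2 (X n) u) \<longlonglongrightarrow> J2 t0 u"
        using AE_lborel_singleton[of "t0 - m"]
      proof eventually_elim
        case (elim u)
        show ?case
        proof (cases "u < t0 - m")
          case True
          then have "(\<lambda>n. f (X n - u)) \<longlonglongrightarrow> f (t0 - u)"
            by (intro isCont_tendsto_compose[OF isCont_f] tendsto_intros X) (use m in auto)
          then have l: "(\<lambda>n. g u * f (X n - u)) \<longlonglongrightarrow> g u * f (t0 - u)" by (intro tendsto_intros)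
          have "eventually (\<lambda>n. u + m < X n) sequentially"
            using order_tendstoD(1)[OF X, of "u + m"] True by simp
          then have "eventually (\<lambda>n. g u * f (X n - u) = J2 (X n) u) sequentially"
            by eventually_elim (auto simp: J2_def)
          then have "(\<lambda>n. J2 (X n) u) \<longlonglongrightarrow> g u * f (t0 - u)"
            by (rule Lim_transform_eventually[OF l])
          then show ?thesis using True by (simp add: J2_def)
        next
          case False
          then have "t0 < u + m" using elim by auto
          then have "eventually (\<lambda>n. X n < u + m) sequentially"
            using order_tendstoD(2)[OF X, of "u + m"] by simp
          then have "eventually (\<lambda>n. J2 (X n) u = 0) sequentially"
            by eventually_elim (auto simp: J2_def)
          then show ?thesis using False by (simp add: J2_def tendsto_eventually)
        qed
      qed
      show "AE u in lborel. norm (J2 (X n) u) \<le> w2 u" for n using b2[OF XU] by simp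
    qed auto
  qed
  have "((\<lambda>t. enn2real (tail_convolution \<nu> f t)) \<longlongrightarrow> enn2real (tail_convolution \<nu> f t0)) (at t0 within U)"
    unfolding tendsto_at_iff_sequentially
  proof (intro allI impI)
    fix X :: "nat \<Rightarrow> real" assume X: "\<forall>i. X i \<in> U - {t0}" "X \<longlonglongrightarrow> t0"
    have J0: "0 \<le> J t" for t unfolding J_def using nn by (intro add_nonneg_nonneg integral_nonneg) auto
    show "((\<lambda>t. enn2real (tail_convolution \<nu> f t)) \<circ> X) \<longlonglongrightarrow> enn2real (tail_convolution \<nu> f t0)"
      using lim[of X] X J_eq U(2) J0 by (simp add: comp_def)
  qed
  then show "isCont (\<lambda>t. enn2real (tail_convolution \<nu> f t)) t0"
    unfolding isCont_def using at_within_open[OF U(2,1)] by simp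
qed

lemma density_equation_imp_integral_equation:
  assumes ae: "AE t in lborel. ennreal (t * f t) = ennreal (a * f t) + tail_convolution \<nu> f t"
    and t: "a \<le> t"
  shows "(a - t) * f t + (LBINT s=a..t. measure \<nu> {t - s<..} * f s) = 0"
\<comment> \<open>At \<open>t = a\<close> both terms vanish by themselves; continuity of f is given
  only beyond a.\<close>
proof (cases "t = a")
  case False
  then have t: "a < t" using t by simp
  define h where "h = (\<lambda>x. (a - x) * f x + enn2real (tail_convolution \<nu> f x))"
  have "h t = 0"
  proof (rule isCont_AE_zero[where h=h and t=t and u="t + 1"])
    show "isCont h t"
      unfolding h_def using isCont_f[OF t] tail_convolution_continuous(2)[OF t] by (intro continuous_intros)
    show "t < t + 1" by simp
    show "AE x in lborel. t < x \<longrightarrow> x < t + 1 \<longrightarrow> h x = 0"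
      using ae
    proof eventually_elim
      case (elim x)
      have "h x = 0" if "t < x"
      proof -
        have x: "a < x" using t that by simp
        obtain j where j: "tail_convolution \<nu> f x = ennreal j" "0 \<le> j"
          using tail_convolution_continuous(1)[OF x] by (cases "tail_convolution \<nu> f x") auto
        have "ennreal (x * f x) = ennreal (a * f x + j)"
          using elim j a_nonneg f_nonneg[of x] by (simp add: ennreal_plus)
        then have "x * f x = a * f x + j"
          using j a_nonneg f_nonneg[of x] x by (subst (asm) ennreal_inj) auto
        then show ?thesis using j by (simp add: h_def algebra_simps)
      qed
      then show ?case by simp
    qed
  qed
  then show ?thesis
    unfolding h_def using interval_integral_eq_tail_convolution[OF levy, of t] t by simp
qed simp

end

lemma selfdecomposable_iff_integral_equation:
  "selfdecomposable \<mu> \<longleftrightarrow>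
    (\<exists>\<nu>. subordinator_levy_measure \<nu> \<and>
         (\<integral>\<^sup>+x\<in>{0<..}. ennreal (ln_plus x) \<partial>\<nu>) < \<infinity> \<and>
         (\<forall>t\<ge>a. (a - t) * f t + (LBINT s=a..t. measure \<nu> {t - s<..} * f s) = 0))"
proof
  assume "selfdecomposable \<mu>"
  then obtain \<nu> where levy: "subordinator_levy_measure \<nu>"
    and ae: "AE t in lborel. ennreal (t * f t) = ennreal (a * f t) + tail_convolution \<nu> f t"
    by (rule selfdecomposable_imp_density_equation)
  have "log_derivative \<mu> a \<nu>" by (rule density_equation_imp_log_derivative[OF levy a_nonneg ae])
  then have "(\<integral>\<^sup>+x\<in>{0<..}. ennreal (ln_plus x) \<partial>\<nu>) < \<infinity>"
    by (rule log_moment_finite[OF nonneg_law_mu levy a_nonneg])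
  then show "\<exists>\<nu>. subordinator_levy_measure \<nu> \<and>
         (\<integral>\<^sup>+x\<in>{0<..}. ennreal (ln_plus x) \<partial>\<nu>) < \<infinity> \<and>
         (\<forall>t\<ge>a. (a - t) * f t + (LBINT s=a..t. measure \<nu> {t - s<..} * f s) = 0)"
    using levy density_equation_imp_integral_equation[OF levy ae] by blast
next
  assume "\<exists>\<nu>. subordinator_levy_measure \<nu> \<and>
         (\<integral>\<^sup>+x\<in>{0<..}. ennreal (ln_plus x) \<partial>\<nu>) < \<infinity> \<and>
         (\<forall>t\<ge>a. (a - t) * f t + (LBINT s=a..t. measure \<nu> {t - s<..} * f s) = 0)"
  then obtain \<nu> where levy: "subordinator_levy_measure \<nu>"
    and eq: "\<forall>t\<ge>a. (a - t) * f t + (LBINT s=a..t. measure \<nu> {t - s<..} * f s) = 0" by blast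
  show "selfdecomposable \<mu>"
    by (rule log_derivative_imp_selfdecomposable[OF nonneg_law_mu levy a_nonneg
        density_equation_imp_log_derivative[OF levy a_nonneg
          integral_equation_imp_density_equation[OF levy eq]]])
qed

end

theorem corollary3p4:
  fixes a :: real and f :: "real \<Rightarrow> real"
  assumes "a \<ge> 0"
    and "f \<in> borel_measurable borel"
    and "\<And>t. f t \<ge> 0"
    and "(\<integral>\<^sup>+t. ennreal (f t) \<partial>lborel) = 1"
    and "closure {t. f t \<noteq> 0} = {a..}"
    and "continuous_on {a<..} f"
  shows "selfdecomposable (density lborel (\<lambda>t. ennreal (f t))) \<longleftrightarrow>
    (\<exists>\<nu>. subordinator_levy_measure \<nu> \<and>
         (\<integral>\<^sup>+x\<in>{0<..}. ennreal (ln_plus x) \<partial>\<nu>) < \<infinity> \<and>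
         (\<forall>t\<ge>a. (a - t) * f t + (LBINT s=a..t. measure \<nu> {t - s<..} * f s) = 0))"
proof -
  interpret half_line_density a f
    by (rule half_line_density.intro) (rule assms)+
  show ?thesis using selfdecomposable_iff_integral_equation unfolding \<mu>_def .
qed

end
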